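(* Let $(X,\mu)$ be a standard probability space and let $\mathbb G\leq\mathrm{Aut}(X,\mu)$ be an ergodic full group admitting a Polish group topology. Then $\mathbb G$ is a Borel subset of $\mathrm{Aut}(X,\mu)$ for the weak topology.
   Context: A standard probability space is a standard Borel space equipped with a non-atomic Borel probability measure. $\mathrm{Aut}(X,\mu)$ is the group of measure-preserving Borel bijections of $(X,\mu)$, identified when equal almost everywhere. The weak topology on it is the Polish group topology for which $T_n\to T$ iff $\mu(T_n(A)\triangle T(A))\to0$ for all measurable $A$. A subgroup $\mathbb G\leq\mathrm{Aut}(X,\mu)$ is a full group if it is stable under cutting and pasting: whenever $(T_n)_{n\in\mathbb N}$ is a sequence in $\mathbb G$, $(A_n)_{n\in\mathbb N}$ is a measurable partition of $X$ and $T\in\mathrm{Aut}(X,\mu)$ satisfies $T_{\restriction A_n}=T_{n\restriction A_n}$ for all $n$, then $T\in\mathbb G$. It is ergodic if the only measurable sets $A$ with $\mu(A\triangle gA)=0$ for all $g\in\mathbb G$ are those of measure $0$ or $1$. A Polish group topology on a group is a Polish topology making it a topological group. *)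

theory Defs
  imports "HOL-Probability.Probability" "HOL-Algebra.Group"
begin

definition Polish_space :: "'a topology \<Rightarrow> bool" where
  "Polish_space X \<longleftrightarrow> completely_metrizable_space X \<and> separable_space X"

definition borel_sets_of :: "'a topology \<Rightarrow> 'a set set" where
  "borel_sets_of X = sigma_sets (topspace X) {U. openin X U}"

definition standard_borel_space :: "'a measure \<Rightarrow> bool" where
  "standard_borel_space M \<longleftrightarrow>
     (\<exists>X. Polish_space X \<and> topspace X = space M \<and> sets M = borel_sets_of X)"

definition non_atomic :: "'a measure \<Rightarrow> bool" where
  "non_atomic M \<longleftrightarrow>
     (\<forall>A\<in>sets M. emeasure M A > 0 \<longrightarrow>
        (\<exists>B\<in>sets M. B \<subseteq> A \<and> 0 < emeasure M B \<and> emeasure M B < emeasure M A))"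

definition standard_prob_space :: "'a measure \<Rightarrow> bool" where
  "standard_prob_space M \<longleftrightarrow> prob_space M \<and> standard_borel_space M \<and> non_atomic M"


text \<open>A Borel bijection is a bijection that is Borel in both directions. Values outside
  \<open>space M\<close> are irrelevant: they are identified by the equivalence relation below.\<close>

definition mp_bij :: "'a measure \<Rightarrow> ('a \<Rightarrow> 'a) set" where
  "mp_bij M = {f. bij_betw f (space M) (space M) \<and> f \<in> measurable M M \<and>
     inv_into (space M) f \<in> measurable M M \<and> distr M M f = M}"

definition ae_eq :: "'a measure \<Rightarrow> (('a \<Rightarrow> 'a) \<times> ('a \<Rightarrow> 'a)) set" where
  "ae_eq M = {(f, g). f \<in> mp_bij M \<and> g \<in> mp_bij M \<and> (AE x in M. f x = g x)}"

abbreviation ae_class :: "'a measure \<Rightarrow> ('a \<Rightarrow> 'a) \<Rightarrow> ('a \<Rightarrow> 'a) set" where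
  "ae_class M f \<equiv> ae_eq M `` {f}"

definition Aut :: "'a measure \<Rightarrow> ('a \<Rightarrow> 'a) set monoid" where
  "Aut M = \<lparr>carrier = mp_bij M // ae_eq M,
     mult = (\<lambda>S T. \<Union>f\<in>S. \<Union>g\<in>T. ae_class M (f \<circ> g)),
     one = ae_class M id\<rparr>"

text \<open>The subbasic sets are \<open>{[f]. \<mu>(f(A) \<triangle> g(A)) < e}\<close>; that this topology has the defining
  convergence of the weak topology is \<open>limitin_weak_topology\<close> below.\<close>

definition weak_topology :: "'a measure \<Rightarrow> ('a \<Rightarrow> 'a) set topology" where
  "weak_topology M = topology_generated_by
     {{ae_class M f |f. f \<in> mp_bij M \<and> measure M (sym_diff (f ` A) (g ` A)) < e} |g A e.
       g \<in> mp_bij M \<and> A \<in> sets M \<and> e > 0}"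

definition full_group :: "'a measure \<Rightarrow> ('a \<Rightarrow> 'a) set set \<Rightarrow> bool" where
  "full_group M G \<longleftrightarrow> subgroup G (Aut M) \<and>
     (\<forall>t A s. (\<forall>n::nat. t n \<in> mp_bij M \<and> ae_class M (t n) \<in> G) \<longrightarrow>
        (\<forall>n. A n \<in> sets M) \<longrightarrow> disjoint_family A \<longrightarrow> (\<Union>n. A n) = space M \<longrightarrow>
        s \<in> mp_bij M \<longrightarrow> (\<forall>n. AE x in M. x \<in> A n \<longrightarrow> s x = t n x) \<longrightarrow>
        ae_class M s \<in> G)"

definition ergodic :: "'a measure \<Rightarrow> ('a \<Rightarrow> 'a) set set \<Rightarrow> bool" where
  "ergodic M G \<longleftrightarrow>
     (\<forall>A\<in>sets M. (\<forall>S\<in>G. \<forall>f\<in>S. measure M (sym_diff A (f ` A)) = 0) \<longrightarrow>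
        measure M A = 0 \<or> measure M A = 1)"

definition Polish_group_topology :: "('g, 'b) monoid_scheme \<Rightarrow> 'g topology \<Rightarrow> bool" where
  "Polish_group_topology H X \<longleftrightarrow> topspace X = carrier H \<and> Polish_space X \<and>
     continuous_map (prod_topology X X) X (\<lambda>(x, y). x \<otimes>\<^bsub>H\<^esub> y) \<and>
     continuous_map X X (\<lambda>x. inv\<^bsub>H\<^esub> x)"


lemma mp_bijD:
  assumes "f \<in> mp_bij M"
  shows "bij_betw f (space M) (space M)" "f \<in> measurable M M"
    "inv_into (space M) f \<in> measurable M M" "distr M M f = M"
  using assms by (auto simp: mp_bij_def)

lemma mp_bij_id: "id \<in> mp_bij M"
proof -
  have "inv_into (space M) id \<in> measurable M M \<longleftrightarrow> id \<in> measurable M M"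
    by (rule measurable_cong) (use inv_into_f_f[of id "space M"] in simp)
  moreover have "id \<in> measurable M M" by (simp add: id_def)
  ultimately show ?thesis by (simp add: mp_bij_def) (simp add: id_def)
qed

lemma mp_bij_comp:
  assumes "f \<in> mp_bij M" "g \<in> mp_bij M"
  shows "f \<circ> g \<in> mp_bij M"
proof -
  note f = mp_bijD[OF assms(1)] and g = mp_bijD[OF assms(2)]
  have b: "bij_betw (f \<circ> g) (space M) (space M)"
    using bij_betw_trans[OF g(1) f(1)] .
  have "inv_into (space M) (f \<circ> g) \<in> measurable M M \<longleftrightarrow>
      inv_into (space M) g \<circ> inv_into (space M) f \<in> measurable M M"
  proof (rule measurable_cong)
    fix x assume x: "x \<in> space M"
    define y where "y = inv_into (space M) g (inv_into (space M) f x)"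
    have y: "y \<in> space M" "(f \<circ> g) y = x"
      using x f(1) g(1) unfolding y_def
      by (auto simp: bij_betw_inv_into_right bij_betw_apply[OF bij_betw_inv_into])
    then have "inv_into (space M) (f \<circ> g) x = y"
      using b by (metis bij_betw_inv_into_left)
    then show "inv_into (space M) (f \<circ> g) x = (inv_into (space M) g \<circ> inv_into (space M) f) x"
      by (simp add: y_def)
  qed
  moreover have "distr M M (f \<circ> g) = M"
    using distr_distr[OF f(2) g(2)] f(4) g(4) by simp
  ultimately show ?thesis
    using b f(2,3) g(2,3) by (simp add: mp_bij_def)
qed

lemma mp_bij_inv:
  assumes "f \<in> mp_bij M"
  shows "inv_into (space M) f \<in> mp_bij M"
proof -
  note f = mp_bijD[OF assms]
  let ?h = "inv_into (space M) f"
  have b: "bij_betw ?h (space M) (space M)"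
    by (rule bij_betw_inv_into[OF f(1)])
  have "inv_into (space M) ?h \<in> measurable M M \<longleftrightarrow> f \<in> measurable M M"
    by (rule measurable_cong) (rule inv_into_inv_into_eq[OF f(1)])
  moreover have "distr M M ?h = M"
  proof -
    have "distr M M ?h = distr (distr M M f) M ?h" by (simp add: f(4))
    also have "\<dots> = distr M M (?h \<circ> f)" by (rule distr_distr[OF f(3,2)])
    also have "\<dots> = distr M M id"
      by (rule distr_cong) (use f(1) in \<open>auto simp: bij_betw_inv_into_left\<close>)
    also have "\<dots> = M" by (simp add: id_def)
    finally show ?thesis .
  qed
  ultimately show ?thesis using b f(2,3) by (simp add: mp_bij_def)
qed

lemma mp_bij_image:
  assumes "f \<in> mp_bij M" "A \<in> sets M"
  shows "f ` A \<in> sets M" "measure M (f ` A) = measure M A"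
proof -
  note f = mp_bijD[OF assms(1)]
  have A: "A \<subseteq> space M" using assms(2) by (rule sets.sets_into_space)
  have "f ` A = inv_into (space M) f -` A \<inter> space M"
  proof (intro equalityI subsetI)
    fix y assume "y \<in> f ` A"
    then show "y \<in> inv_into (space M) f -` A \<inter> space M"
      using f(1) A by (auto simp: bij_betw_inv_into_left bij_betw_apply subset_iff)
  next
    fix x assume x: "x \<in> inv_into (space M) f -` A \<inter> space M"
    then have "x = f (inv_into (space M) f x)"
      using bij_betw_inv_into_right[OF f(1)] by simp
    then show "x \<in> f ` A" using x by blast
  qed
  then show s: "f ` A \<in> sets M" using f(3) assms(2) by (simp add: measurable_sets)
  have "f -` (f ` A) \<inter> space M = A"
    using A f(1) by (auto simp: bij_betw_def inj_on_def)
  then show "measure M (f ` A) = measure M A"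
    using measure_distr[OF f(2) s] f(4) by simp
qed

lemma mp_bij_AE:
  assumes f: "f \<in> mp_bij M" and P: "AE x in M. P x"
  shows "AE x in M. P (f x)"
proof (rule AE_distrD[OF mp_bijD(2)[OF f]])
  show "AE x in distr M M f. P x" unfolding mp_bijD(4)[OF f] by (rule P)
qed

lemma equiv_ae_eq: "equiv (mp_bij M) (ae_eq M)"
proof (rule equivI)
  show "ae_eq M \<subseteq> mp_bij M \<times> mp_bij M" by (auto simp: ae_eq_def)
  show "refl_on (mp_bij M) (ae_eq M)" by (auto simp: refl_on_def ae_eq_def)
  show "sym (ae_eq M)" by (simp add: sym_def ae_eq_def eq_commute)
  show "trans (ae_eq M)"
  proof (rule transI)
    fix f g h assume "(f, g) \<in> ae_eq M" "(g, h) \<in> ae_eq M"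
    then have "f \<in> mp_bij M" "h \<in> mp_bij M" "AE x in M. f x = g x" "AE x in M. g x = h x"
      by (auto simp: ae_eq_def)
    moreover from this(3,4) have "AE x in M. f x = h x" by eventually_elim simp
    ultimately show "(f, h) \<in> ae_eq M" by (simp add: ae_eq_def)
  qed
qed

lemma ae_class_eq_iff:
  "f \<in> mp_bij M \<Longrightarrow> g \<in> mp_bij M \<Longrightarrow> ae_class M f = ae_class M g \<longleftrightarrow> (AE x in M. f x = g x)"
  using eq_equiv_class_iff[OF equiv_ae_eq, of f M g] by (simp add: ae_eq_def)

lemma Aut_mult:
  assumes f: "f \<in> mp_bij M" and g: "g \<in> mp_bij M"
  shows "ae_class M f \<otimes>\<^bsub>Aut M\<^esub> ae_class M g = ae_class M (f \<circ> g)"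
proof -
  have *: "ae_class M (f' \<circ> g') = ae_class M (f \<circ> g)"
    if "f' \<in> ae_class M f" "g' \<in> ae_class M g" for f' g'
  proof -
    from that have m: "f' \<in> mp_bij M" "g' \<in> mp_bij M"
      and ae: "AE x in M. f x = f' x" "AE x in M. g x = g' x"
      by (auto simp: ae_eq_def)
    have "AE x in M. (f' \<circ> g') x = (f \<circ> g) x"
      using mp_bij_AE[OF m(2) ae(1)] ae(2) by eventually_elim simp
    then show ?thesis using m f g by (simp add: ae_class_eq_iff mp_bij_comp)
  qed
  have mem: "f \<in> ae_class M f" "g \<in> ae_class M g"
    using f g by (auto simp: ae_eq_def)
  have "(\<Union>f'\<in>ae_class M f. \<Union>g'\<in>ae_class M g. ae_class M (f' \<circ> g')) =
      (\<Union>f'\<in>ae_class M f. \<Union>g'\<in>ae_class M g. ae_class M (f \<circ> g))"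
    by (intro SUP_cong refl *)
  also have "\<dots> = ae_class M (f \<circ> g)" using mem by blast
  finally show ?thesis by (simp add: Aut_def)
qed

lemma group_Aut: "group (Aut M)"
proof (rule groupI)
  have carrier_def: "S \<in> carrier (Aut M) \<longleftrightarrow> (\<exists>f\<in>mp_bij M. S = ae_class M f)" for S
    by (auto simp: Aut_def quotient_def)
  have one: "\<one>\<^bsub>Aut M\<^esub> = ae_class M id" by (simp add: Aut_def)
  fix S assume "S \<in> carrier (Aut M)"
  then obtain f where f: "f \<in> mp_bij M" "S = ae_class M f" by (auto simp: carrier_def)
  show "\<one>\<^bsub>Aut M\<^esub> \<otimes>\<^bsub>Aut M\<^esub> S = S"
    unfolding one f(2) by (subst Aut_mult) (auto simp: f mp_bij_id)
  show "\<exists>T\<in>carrier (Aut M). T \<otimes>\<^bsub>Aut M\<^esub> S = \<one>\<^bsub>Aut M\<^esub>"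
  proof
    let ?h = "inv_into (space M) f"
    show "ae_class M ?h \<in> carrier (Aut M)"
      using mp_bij_inv[OF f(1)] by (auto simp: carrier_def)
    have "AE x in M. (?h \<circ> f) x = id x"
      by (rule AE_I2) (simp add: bij_betw_inv_into_left[OF mp_bijD(1)[OF f(1)]])
    then have "ae_class M (?h \<circ> f) = ae_class M id"
      using f(1) by (subst ae_class_eq_iff) (auto intro: mp_bij_comp mp_bij_inv mp_bij_id)
    then show "ae_class M ?h \<otimes>\<^bsub>Aut M\<^esub> S = \<one>\<^bsub>Aut M\<^esub>"
      using f by (simp add: Aut_mult mp_bij_inv one)
  qed
  fix T assume "T \<in> carrier (Aut M)"
  then obtain g where g: "g \<in> mp_bij M" "T = ae_class M g" by (auto simp: carrier_def)
  show "S \<otimes>\<^bsub>Aut M\<^esub> T \<in> carrier (Aut M)"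
    using f g by (auto simp: Aut_mult carrier_def intro: mp_bij_comp)
  fix U assume "U \<in> carrier (Aut M)"
  then obtain h where h: "h \<in> mp_bij M" "U = ae_class M h" by (auto simp: carrier_def)
  show "S \<otimes>\<^bsub>Aut M\<^esub> T \<otimes>\<^bsub>Aut M\<^esub> U = S \<otimes>\<^bsub>Aut M\<^esub> (T \<otimes>\<^bsub>Aut M\<^esub> U)"
    using f g h by (simp add: Aut_mult mp_bij_comp comp_assoc)
next
  show "\<one>\<^bsub>Aut M\<^esub> \<in> carrier (Aut M)"
    using mp_bij_id by (auto simp: Aut_def quotient_def)
qed

lemma ae_eq_image_null:
  assumes fg: "(f, g) \<in> ae_eq M" and A: "A \<in> sets M"
  shows "AE x in M. x \<in> f ` A \<longleftrightarrow> x \<in> g ` A"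
proof -
  have f: "f \<in> mp_bij M" and g: "g \<in> mp_bij M" and ae: "AE x in M. f x = g x"
    using fg by (auto simp: ae_eq_def)
  have AM: "A \<subseteq> space M" by (rule sets.sets_into_space[OF A])
  have img: "AE x in M. (\<exists>y\<in>space M. x = h y \<and> f y = g y)" if h: "h \<in> mp_bij M" for h
  proof -
    have "AE x in M. f (inv_into (space M) h x) = g (inv_into (space M) h x)"
      by (rule mp_bij_AE[OF mp_bij_inv[OF h] ae])
    then show ?thesis
    proof (rule AE_mp, intro AE_I2 impI)
      fix x assume "x \<in> space M"
        "f (inv_into (space M) h x) = g (inv_into (space M) h x)"
      moreover have "inv_into (space M) h x \<in> space M" "h (inv_into (space M) h x) = x"
        using \<open>x \<in> space M\<close> mp_bijD(1)[OF h]
        by (auto simp: bij_betw_inv_into_right bij_betw_apply[OF bij_betw_inv_into])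
      ultimately show "\<exists>y\<in>space M. x = h y \<and> f y = g y"
        by (intro bexI[of _ "inv_into (space M) h x"]) simp_all
    qed
  qed
  have inj: "inj_on f (space M)" "inj_on g (space M)"
    using mp_bijD(1)[OF f] mp_bijD(1)[OF g] by (auto simp: bij_betw_def)
  show ?thesis using img[OF f] img[OF g]
  proof eventually_elim
    case (elim x)
    then obtain y z where y: "y \<in> space M" "x = f y" "f y = g y"
      and z: "z \<in> space M" "x = g z" "f z = g z" by blast
    have "g y = g z" using y z by simp
    then have "y = z" using inj_onD[OF inj(2)] y(1) z(1) by blast
    then have g_y: "x = g y" using z by simp
    show ?case
      unfolding inj_on_image_mem_iff[OF inj(1) y(1) AM, folded y(2)]
        inj_on_image_mem_iff[OF inj(2) y(1) AM, folded g_y] ..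
  qed
qed

lemma measure_sym_diff_triangle:
  assumes "prob_space M" "A \<in> sets M" "B \<in> sets M" "C \<in> sets M"
  shows "measure M (sym_diff A C) \<le> measure M (sym_diff A B) + measure M (sym_diff B C)"
proof -
  interpret prob_space M by fact
  have "measure M (sym_diff A C) \<le> measure M (sym_diff A B \<union> sym_diff B C)"
    using assms by (intro finite_measure_mono) auto
  also have "\<dots> \<le> measure M (sym_diff A B) + measure M (sym_diff B C)"
    using assms by (intro measure_Un_le) auto
  finally show ?thesis .
qed

lemma topspace_weak_topology: "topspace (weak_topology M) = carrier (Aut M)"
proof -
  let ?B = "{{ae_class M f |f. f \<in> mp_bij M \<and> measure M (sym_diff (f ` A) (g ` A)) < e} |g A e.
       g \<in> mp_bij M \<and> A \<in> sets M \<and> e > 0}"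
  have "{ae_class M f |f. f \<in> mp_bij M} \<in> ?B"
    using mp_bij_id[of M]
    by (intro CollectI exI[of _ id] exI[of _ "{}"] exI[of _ "1::real"]) auto
  moreover have "U \<subseteq> {ae_class M f |f. f \<in> mp_bij M}" if "U \<in> ?B" for U
    using that by auto
  ultimately have "\<Union>?B = {ae_class M f |f. f \<in> mp_bij M}"
    by (intro equalityI Union_least Union_upper)
  moreover have "topspace (weak_topology M) = \<Union>?B"
    unfolding weak_topology_def by (rule topology_generated_by_topspace)
  moreover have "carrier (Aut M) = {ae_class M f |f. f \<in> mp_bij M}"
    by (auto simp: Aut_def quotient_def)
  ultimately show ?thesis by simp
qed

lemma limitin_weak_topology:
  assumes M: "prob_space M" and t: "\<And>n. t n \<in> mp_bij M" and s: "s \<in> mp_bij M"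
  shows "limitin (weak_topology M) (\<lambda>n. ae_class M (t n)) (ae_class M s) sequentially \<longleftrightarrow>
     (\<forall>A\<in>sets M. (\<lambda>n. measure M (sym_diff (t n ` A) (s ` A))) \<longlonglongrightarrow> 0)"
    (is "?L \<longleftrightarrow> ?R")
proof -
  let ?N = "\<lambda>g A e. {ae_class M f |f. f \<in> mp_bij M \<and> measure M (sym_diff (f ` A) (g ` A)) < e}"
  let ?B = "{?N g A e |g A e. g \<in> mp_bij M \<and> A \<in> sets M \<and> e > 0}"
  have mem: "ae_class M f \<in> ?N g A e \<longleftrightarrow> measure M (sym_diff (f ` A) (g ` A)) < e"
    if f: "f \<in> mp_bij M" and g: "g \<in> mp_bij M" and A: "A \<in> sets M" for f g A and e :: real
  proof
    assume "ae_class M f \<in> ?N g A e"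
    then obtain f' where f': "f' \<in> mp_bij M" "ae_class M f = ae_class M f'"
      and lt: "measure M (sym_diff (f' ` A) (g ` A)) < e" by blast
    have "(f, f') \<in> ae_eq M"
      using iffD1[OF ae_class_eq_iff[OF f f'(1)] f'(2)] f f'(1) by (simp add: ae_eq_def)
    from ae_eq_image_null[OF this A]
    have "measure M (sym_diff (f ` A) (g ` A)) = measure M (sym_diff (f' ` A) (g ` A))"
      using f f' g A by (intro measure_eq_AE) (auto intro!: sets.Un sets.Diff mp_bij_image)
    with lt show "measure M (sym_diff (f ` A) (g ` A)) < e" by simp
  qed (use f in blast)
  show ?thesis
  proof
    assume L: ?L
    show ?R
    proof
      fix A assume A: "A \<in> sets M"
      show "(\<lambda>n. measure M (sym_diff (t n ` A) (s ` A))) \<longlonglongrightarrow> 0"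
      proof (rule tendstoI)
        fix e :: real assume e: "e > 0"
        have "?N s A e \<in> ?B" using s A e by blast
        then have "openin (weak_topology M) (?N s A e)"
          unfolding weak_topology_def by (rule topology_generated_by_Basis)
        moreover have "ae_class M s \<in> ?N s A e" using mem[OF s s A] e by simp
        ultimately have "\<forall>\<^sub>F n in sequentially. ae_class M (t n) \<in> ?N s A e"
          using L unfolding limitin_def by blast
        then show "\<forall>\<^sub>F n in sequentially. dist (measure M (sym_diff (t n ` A) (s ` A))) 0 < e"
          unfolding mem[OF t s A] by simp
      qed
    qed
  next
    assume R: ?R
    have "\<forall>\<^sub>F n in sequentially. ae_class M (t n) \<in> U"
      if "generate_topology_on ?B U" "ae_class M s \<in> U" for U
      using that
    proof (induction rule: generate_topology_on.induct)
      case (Int a b)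
      then have "\<forall>\<^sub>F n in sequentially. ae_class M (t n) \<in> a"
        "\<forall>\<^sub>F n in sequentially. ae_class M (t n) \<in> b" by blast+
      then show ?case by eventually_elim blast
    next
      case (UN K)
      then obtain k where k: "k \<in> K" "ae_class M s \<in> k" by blast
      from UN.IH[OF k] show ?case by eventually_elim (use k in blast)
    next
      case (Basis b)
      then obtain g A e where b: "b = ?N g A e" and g: "g \<in> mp_bij M" and A: "A \<in> sets M" by blast
      let ?d = "measure M (sym_diff (s ` A) (g ` A))"
      have "?d < e" using Basis(2) mem[OF s g A] by (simp add: b)
      then have "\<forall>\<^sub>F n in sequentially. measure M (sym_diff (t n ` A) (s ` A)) < e - ?d"
        using R A by (intro order_tendstoD(2)) auto
      then show ?case
      proof eventually_elim
        case (elim n)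
        have "measure M (sym_diff (t n ` A) (g ` A)) < e"
          using measure_sym_diff_triangle[OF M, of "t n ` A" "s ` A" "g ` A"] elim
            mp_bij_image(1)[OF t A] mp_bij_image(1)[OF s A] mp_bij_image(1)[OF g A] by simp
        then show ?case using mem[OF t g A] by (simp add: b)
      qed
    qed simp
    then have "\<forall>U. openin (weak_topology M) U \<and> ae_class M s \<in> U \<longrightarrow>
        (\<forall>\<^sub>F n in sequentially. ae_class M (t n) \<in> U)"
      unfolding weak_topology_def openin_topology_generated_by_iff by blast
    moreover have "ae_class M s \<in> topspace (weak_topology M)"
      unfolding topspace_weak_topology using s by (auto simp: Aut_def quotient_def)
    ultimately show ?L unfolding limitin_def by blast
  qed
qed

end

theory Submission
  imports Defs
begin

text \<open>
  Let \<open>\<tau>\<close> be a Polish group topology on \<open>G\<close>. Ergodicity and fullness provide, inside every set of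
  positive measure, two non-commuting elements of \<open>G\<close>; hence \<open>T A\<close> and \<open>B\<close> are disjoint up to a null
  set if and only if \<open>T U T\<^sup>-\<^sup>1\<close> commutes with \<open>V\<close> for all \<open>U\<close>, \<open>V\<close> in \<open>G\<close> supported in \<open>A\<close> and in \<open>B\<close>,
  which is a \<open>\<tau>\<close>-closed condition on \<open>T\<close>. Consequently, if \<open>T\<^sub>n\<close> converges to \<open>T\<close> for \<open>\<tau>\<close> and \<open>T\<^sub>n A\<close> is
  Cauchy in measure, then \<open>T\<^sub>n A\<close> converges to \<open>T A\<close>: the graph of the inclusion of \<open>G\<close> into the
  automorphism group is closed. The sum of a complete metric for \<open>\<tau>\<close> and of the weak pseudometric
  \<open>weighted_dist\<close> is therefore complete, and separable, and it makes the inclusion continuous, so that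
  \<open>G\<close> is Borel by the Lusin-Souslin theorem.
\<close>

section \<open>Injective continuous images of Polish spaces\<close>

text \<open>Nothing relates \<tau> to the weak topology in advance: the inclusion of G is only known
  to be a homomorphism. Hence disjointness of T A and B has to be expressed through products and
  inverses alone, which are all that \<tau> is compatible with. A second obstacle is that the weak
  pseudometric is not complete on the automorphism group: when all the sets T_n A converge, their
  limits may describe an embedding of the measure algebra that is not onto. For this reason the
  complete metric for \<tau> supplies the candidate limit, and the closed conditions only have to
  identify it. The sum of the two metrics is the metric of the graph of the inclusion, so its
  completeness is the closedness of that graph. Of the weak topology, the final step asks only that
  it be Hausdorff.\<close>

definition borel_separated :: "'a topology \<Rightarrow> 'a set \<Rightarrow> 'a set \<Rightarrow> bool" where
  "borel_separated Y A B \<longleftrightarrow> (\<exists>E\<in>borel_sets_of Y. A \<subseteq> E \<and> B \<inter> E = {})"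

lemma sets_sigma_borel_sets_of:
  "sets (sigma (topspace Y) {U. openin Y U}) = borel_sets_of Y"
  unfolding borel_sets_of_def by (rule sets_measure_of) (auto dest: openin_subset)

lemma openin_borel_sets_of: "openin Y U \<Longrightarrow> U \<in> borel_sets_of Y"
  unfolding borel_sets_of_def by (rule sigma_sets.Basic) simp

lemma closedin_borel_sets_of:
  assumes "closedin Y C"
  shows "C \<in> borel_sets_of Y"
proof -
  have "topspace Y - (topspace Y - C) \<in> borel_sets_of Y"
    using assms openin_borel_sets_of[of Y "topspace Y - C"]
    unfolding borel_sets_of_def closedin_def by (metis sigma_sets.Compl)
  moreover have "topspace Y - (topspace Y - C) = C"
    using closedin_subset[OF assms] by (rule double_diff) simp
  ultimately show ?thesis by simp
qed

text \<open>Intersecting the separating sets over j leaves a Borel set around \<open>A i\<close>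
  that misses every \<open>B j\<close>; the union over i still misses them. It is used
  contrapositively: images that cannot be separated have pieces that cannot be separated.\<close>

lemma borel_separated_UN:
  fixes A B :: "nat \<Rightarrow> 'a set"
  assumes "\<And>i j. borel_separated Y (A i) (B j)"
  shows "borel_separated Y (\<Union>i. A i) (\<Union>j. B j)"
proof -
  let ?Y = "sigma (topspace Y) {U. openin Y U}"
  obtain E where E: "\<And>i j. E i j \<in> sets ?Y" "\<And>i j. A i \<subseteq> E i j" "\<And>i j. B j \<inter> E i j = {}"
    using assms unfolding borel_separated_def sets_sigma_borel_sets_of by metis
  have "(\<Union>i. \<Inter>j. E i j) \<in> sets ?Y"
    using E(1) by (intro sets.countable_UN sets.countable_INT) auto
  moreover have "(\<Union>i. A i) \<subseteq> (\<Union>i. \<Inter>j. E i j)"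
    by (intro UN_mono INT_greatest E(2)) simp
  moreover have "(\<Union>j. B j) \<inter> (\<Union>i. \<Inter>j. E i j) = {}"
    using E(3) by (simp add: disjoint_iff) metis
  ultimately show ?thesis
    unfolding borel_separated_def sets_sigma_borel_sets_of by (intro bexI conjI)
qed

lemma separable_metric_cover:
  fixes c :: "nat \<Rightarrow> 'a"
  assumes "Metric_space P d" and "Metric_space.mtopology P d closure_of range c = P" and "r > 0"
  shows "P = (\<Union>i. Metric_space.mcball P d (c i) r)"
proof -
  interpret Metric_space P d by fact
  have "\<exists>i. p \<in> mcball (c i) r" if "p \<in> P" for p
  proof -
    have "p \<in> mtopology closure_of range c" using that assms(2) by simp
    then obtain i where "c i \<in> mball p r"
      unfolding metric_closure_of using \<open>r > 0\<close> by blast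
    then show ?thesis by (auto simp: commute intro!: exI[of _ i])
  qed
  moreover have "(\<Union>i. mcball (c i) r) \<subseteq> P" by (auto simp: mcball_subset_mspace)
  ultimately show ?thesis by blast
qed

text \<open>Only the common point p and the vanishing diameters matter, by continuity of f at p; the
  sets need be neither nested nor closed, which lets the same lemma serve two different families of
  balls.\<close>

lemma continuous_map_eventually_small:
  assumes "Metric_space P d"
    and f: "continuous_map (Metric_space.mtopology P d) Y f"
    and C: "\<And>n. C n \<subseteq> P" "\<And>n x y. x \<in> C n \<Longrightarrow> y \<in> C n \<Longrightarrow> d x y \<le> b n" "b \<longlonglongrightarrow> (0::real)"
    and p: "p \<in> P" "\<And>n. p \<in> C n" and V: "openin Y V" "f p \<in> V"
  shows "\<exists>N. \<forall>n\<ge>N. f ` C n \<subseteq> V"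
proof -
  interpret Metric_space P d by fact
  have "openin mtopology {x \<in> topspace mtopology. f x \<in> V}"
    using f V(1) by (rule openin_continuous_map_preimage)
  then obtain r where r: "r > 0" "mball p r \<subseteq> {x \<in> P. f x \<in> V}"
    unfolding openin_mtopology using p(1) V(2) by auto
  obtain N where "\<And>n. n \<ge> N \<Longrightarrow> b n < r"
    using order_tendstoD(2)[OF C(3) r(1)] by (auto simp: eventually_sequentially)
  then have "C n \<subseteq> mball p r" if "n \<ge> N" for n
    using C(1) C(2)[OF p(2), of _ n] p(1) that by (fastforce simp: subset_iff)
  then show ?thesis using r(2) by blast
qed

text \<open>If no Borel set separated the two images, closed pieces of vanishing diameter with the same
  defect could be chosen inside \<open>A\<close> and \<open>B\<close>; continuity at their limit points gives a contradiction.\<close>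

lemma Lusin_separation:
  assumes P: "Polish_space X" and Y: "Hausdorff_space Y"
    and f: "continuous_map X Y f" and inj: "inj_on f (topspace X)"
    and A: "closedin X A" and B: "closedin X B" and AB: "A \<inter> B = {}"
  shows "borel_separated Y (f ` A) (f ` B)"
proof (rule ccontr)
  assume neg: "\<not> borel_separated Y (f ` A) (f ` B)"
  obtain P d where Pd: "Metric_space P d" and complete: "Metric_space.mcomplete P d"
    and X: "X = Metric_space.mtopology P d"
    using P unfolding Polish_space_def completely_metrizable_space_def by blast
  interpret Metric_space P d by fact
  \<comment> \<open>An empty piece is separated from the other one by the empty set or by the whole
    space.\<close>
  have nonempty: "A' \<noteq> {} \<and> B' \<noteq> {}"
    if "\<not> borel_separated Y (f ` A') (f ` B')" "closedin X A'" "closedin X B'" for A' B'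
  proof -
    have "f ` A' \<subseteq> topspace Y" "f ` B' \<subseteq> topspace Y"
      using closedin_subset[OF that(2)] closedin_subset[OF that(3)] f
      by (auto simp: continuous_map_def)
    moreover have "{} \<in> borel_sets_of Y" "topspace Y \<in> borel_sets_of Y"
      by (simp_all add: openin_borel_sets_of)
    ultimately show ?thesis using that(1) unfolding borel_separated_def by blast
  qed
  obtain D where D: "countable D" "D \<subseteq> topspace X" "X closure_of D = topspace X"
    using P unfolding Polish_space_def separable_space_def by blast
  have "D \<noteq> {}" using D(3) nonempty[OF neg A B] closedin_subset[OF A] by auto
  then obtain c :: "nat \<Rightarrow> 'a" where c: "range c = D"
    using range_from_nat_into[OF _ D(1)] by blast
  have cover: "P = (\<Union>i::nat. mcball (c i) r)" if "r > 0" for r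
    using separable_metric_cover[OF Pd _ that, of c] D(3) by (simp add: c X)
  \<comment> \<open>The pair (A, B) itself qualifies at stage 0, where no size is prescribed; the
    guard \<open>n > 0\<close> also keeps out the radius \<open>1 / real 0 = 0\<close>.\<close>
  define Q where "Q = (\<lambda>n (C, E). closedin X C \<and> closedin X E \<and>
    \<not> borel_separated Y (f ` C) (f ` E) \<and> C \<subseteq> A \<and> E \<subseteq> B \<and> (n > 0 \<longrightarrow>
    (\<exists>a b. C \<subseteq> mcball a (1 / real n) \<and> E \<subseteq> mcball b (1 / real n))))"
  have "\<exists>s. \<forall>n. Q n (s n) \<and> fst (s (Suc n)) \<subseteq> fst (s n) \<and> snd (s (Suc n)) \<subseteq> snd (s n)"
  proof (rule dependent_nat_choice)
    show "\<exists>s. Q 0 s" using neg A B by (auto simp: Q_def)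
    fix s n assume "Q n s"
    then obtain C E where s: "s = (C, E)" and CE: "closedin X C" "closedin X E"
      "\<not> borel_separated Y (f ` C) (f ` E)" "C \<subseteq> A" "E \<subseteq> B"
      by (cases s) (auto simp: Q_def)
    let ?r = "1 / real (Suc n)"
    have *: "f ` S = (\<Union>i. f ` (S \<inter> mcball (c i) ?r))" if "closedin X S" for S
    proof -
      have "S = (\<Union>i. S \<inter> mcball (c i) ?r)"
        using cover[of ?r] closedin_subset[OF that] by (auto simp: X)
      then have "f ` S = f ` (\<Union>i. S \<inter> mcball (c i) ?r)" by simp
      then show ?thesis by (simp only: image_UN)
    qed
    have "\<exists>i j. \<not> borel_separated Y (f ` (C \<inter> mcball (c i) ?r)) (f ` (E \<inter> mcball (c j) ?r))"
    proof (rule ccontr)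
      assume "\<nexists>i j. \<not> borel_separated Y (f ` (C \<inter> mcball (c i) ?r)) (f ` (E \<inter> mcball (c j) ?r))"
      then have "borel_separated Y (f ` C) (f ` E)"
        unfolding *[OF CE(1)] *[OF CE(2)] by (intro borel_separated_UN) blast
      then show False using CE(3) by blast
    qed
    then obtain i j where
      "\<not> borel_separated Y (f ` (C \<inter> mcball (c i) ?r)) (f ` (E \<inter> mcball (c j) ?r))" by blast
    moreover have "closedin X (S \<inter> mcball a ?r)" if "closedin X S" for S a
      using that closedin_mcball unfolding X by (rule closedin_Int)
    ultimately have "Q (Suc n) (C \<inter> mcball (c i) ?r, E \<inter> mcball (c j) ?r)"
      using CE unfolding Q_def by blast
    then show "\<exists>t. Q (Suc n) t \<and> fst t \<subseteq> fst s \<and> snd t \<subseteq> snd s"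
      unfolding s by (intro exI conjI) auto
  qed
  then obtain s where s: "\<And>n. Q n (s n)" "\<And>n. fst (s (Suc n)) \<subseteq> fst (s n)"
    "\<And>n. snd (s (Suc n)) \<subseteq> snd (s n)" by blast
  define C E where "C = fst \<circ> s" and "E = snd \<circ> s"
  have Q: "closedin X (C n)" "closedin X (E n)" "\<not> borel_separated Y (f ` C n) (f ` E n)"
    "C n \<subseteq> A" "E n \<subseteq> B"
    "n > 0 \<Longrightarrow> \<exists>a. C n \<subseteq> mcball a (1 / real n)" "n > 0 \<Longrightarrow> \<exists>a. E n \<subseteq> mcball a (1 / real n)" for n
    using s(1)[of n] unfolding Q_def C_def E_def by (auto split: prod.splits)
  have nest: "\<exists>p\<in>P. (\<forall>n. p \<in> S n) \<and> (\<forall>V. openin Y V \<and> f p \<in> V \<longrightarrow> (\<exists>N. \<forall>n\<ge>N. f ` S n \<subseteq> V))"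
    if S: "\<And>n. closedin X (S n)" "\<And>n. S n \<noteq> {}" "\<And>n. S (Suc n) \<subseteq> S n"
      "\<And>n. n > 0 \<Longrightarrow> \<exists>a. S n \<subseteq> mcball a (1 / real n)" for S
  proof -
    have small: "\<exists>n a. S n \<subseteq> mcball a \<epsilon>" if "\<epsilon> > 0" for \<epsilon>
    proof -
      obtain n where "inverse (real (Suc n)) < \<epsilon>" using reals_Archimedean[OF \<open>\<epsilon> > 0\<close>] by blast
      then show ?thesis using S(4)[of "Suc n"]
        by (metis inverse_eq_divide less_imp_le mcball_subset_concentric order_trans zero_less_Suc)
    qed
    have "\<Inter> (range S) \<noteq> {}"
      using complete S small decseq_SucI[of S] unfolding mcomplete_nest X by blast
    then obtain p where p: "\<And>n. p \<in> S n" by blast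
    then have pP: "p \<in> P" using closedin_subset[OF S(1)] X by auto
    \<comment> \<open>Two points of a ball are at most two radii apart. The shift to
      \<open>Suc n\<close> skips stage 0, which has no size bound.\<close>
    have d: "d x y \<le> 2 / real (Suc n)" if xy: "x \<in> S (Suc n)" "y \<in> S (Suc n)" for n x y
    proof -
      obtain a where "x \<in> mcball a (1 / real (Suc n))" "y \<in> mcball a (1 / real (Suc n))"
        using S(4)[of "Suc n"] xy by blast
      then show ?thesis using triangle[of x a y] by (auto simp: commute)
    qed
    have "\<exists>N. \<forall>n\<ge>N. f ` S n \<subseteq> V" if V: "openin Y V" "f p \<in> V" for V
    proof -
      have lim: "(\<lambda>n. 2 / real (Suc n)) \<longlonglongrightarrow> 0"
        using tendsto_mult_right_zero[OF LIMSEQ_inverse_real_of_nat, of 2] by (simp add: divide_inverse)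
      have "S (Suc n) \<subseteq> P" for n using closedin_subset[OF S(1)] X by auto
      from continuous_map_eventually_small[where C = "\<lambda>n. S (Suc n)", OF Pd f[unfolded X] this d lim pP p V]
      obtain N where "\<And>n. n \<ge> N \<Longrightarrow> f ` S (Suc n) \<subseteq> V" by blast
      then have "f ` S n \<subseteq> V" if "n \<ge> Suc N" for n
        using that by (cases n) auto
      then show ?thesis by blast
    qed
    then show ?thesis using pP p by blast
  qed
  have ne: "C n \<noteq> {}" "E n \<noteq> {}" for n using nonempty[OF Q(3)[of n] Q(1,2)] by auto
  have dec: "C (Suc n) \<subseteq> C n" "E (Suc n) \<subseteq> E n" for n using s by (simp_all add: C_def E_def)
  obtain p where p: "p \<in> P" "\<And>n. p \<in> C n"
    "\<And>V. openin Y V \<Longrightarrow> f p \<in> V \<Longrightarrow> \<exists>N. \<forall>n\<ge>N. f ` C n \<subseteq> V"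
    using nest[of C] Q ne dec by meson
  obtain q where q: "q \<in> P" "\<And>n. q \<in> E n"
    "\<And>V. openin Y V \<Longrightarrow> f q \<in> V \<Longrightarrow> \<exists>N. \<forall>n\<ge>N. f ` E n \<subseteq> V"
    using nest[of E] Q ne dec by meson
  have "p \<noteq> q" using p(2) q(2) Q(4,5) AB by blast
  then have "f p \<noteq> f q" using inj p(1) q(1) by (auto simp: inj_on_def X)
  moreover have "f p \<in> topspace Y" "f q \<in> topspace Y"
    using f p(1) q(1) by (auto simp: continuous_map_def X)
  ultimately obtain V W where VW: "openin Y V" "openin Y W" "f p \<in> V" "f q \<in> W" "disjnt V W"
    using Y unfolding Hausdorff_space_def by blast
  obtain N1 N2 where "\<And>n. n \<ge> N1 \<Longrightarrow> f ` C n \<subseteq> V" "\<And>n. n \<ge> N2 \<Longrightarrow> f ` E n \<subseteq> W"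
    using p(3)[OF VW(1,3)] q(3)[OF VW(2,4)] by blast
  then have "f ` C (max N1 N2) \<subseteq> V" "f ` E (max N1 N2) \<subseteq> W" by auto
  then have "borel_separated Y (f ` C (max N1 N2)) (f ` E (max N1 N2))"
    unfolding borel_separated_def using VW(5) openin_borel_sets_of[OF VW(1)]
    by (intro bexI[of _ V]) (auto simp: disjnt_def)
  then show False using Q(3) by blast
qed

text \<open>Each closed ball \<open>K n i\<close> gets a Borel set \<open>H n i\<close> between its image and the closure of its
  image, such that disjoint balls get disjoint sets. A point lying, for every \<open>n\<close>, in some
  \<open>H n i\<close> singles out balls that meet pairwise and therefore shrink to a preimage.\<close>

theorem Lusin_Souslin:
  assumes P: "Polish_space X" and Y: "Hausdorff_space Y"
    and f: "continuous_map X Y f" and inj: "inj_on f (topspace X)"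
  shows "f ` topspace X \<in> borel_sets_of Y"
proof (cases "topspace X = {}")
  case True
  then show ?thesis by (simp add: openin_borel_sets_of)
next
  case False
  obtain P d where Pd: "Metric_space P d" and complete: "Metric_space.mcomplete P d"
    and X: "X = Metric_space.mtopology P d"
    using P unfolding Polish_space_def completely_metrizable_space_def by blast
  interpret Metric_space P d by fact
  obtain D where D: "countable D" "D \<subseteq> topspace X" "X closure_of D = topspace X"
    using P unfolding Polish_space_def separable_space_def by blast
  have "D \<noteq> {}" using D(3) False by fastforce
  then obtain c :: "nat \<Rightarrow> 'a" where c: "range c = D"
    using range_from_nat_into[OF _ D(1)] by blast
  define K where "K n i = mcball (c i) (1 / real (Suc n))" for n and i :: nat
  have cP: "c i \<in> P" for i using D(2) c X by auto
  have cover: "P = (\<Union>i. K n i)" for n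
    unfolding K_def using D(3) by (intro separable_metric_cover[OF Pd]) (auto simp: c X)
  have KP: "K n i \<subseteq> P" and closed_K: "closedin X (K n i)" for n i
    by (auto simp: K_def X)
  let ?S = "\<lambda>n i m j. borel_separated Y (f ` K n i) (f ` K m j)"
  have "\<exists>E. K n i \<inter> K m j = {} \<longrightarrow>
      E \<in> borel_sets_of Y \<and> f ` K n i \<subseteq> E \<and> f ` K m j \<inter> E = {}" for n i m j
    using Lusin_separation[OF P Y f inj closed_K[of n i] closed_K[of m j]]
    unfolding borel_separated_def by blast
  then obtain E where E: "\<And>n i m j. K n i \<inter> K m j = {} \<Longrightarrow> E n i m j \<in> borel_sets_of Y"
    "\<And>n i m j. K n i \<inter> K m j = {} \<Longrightarrow> f ` K n i \<subseteq> E n i m j"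
    "\<And>n i m j. K n i \<inter> K m j = {} \<Longrightarrow> f ` K m j \<inter> E n i m j = {}"
    by metis
  \<comment> \<open>Subtracting the set that separates in the opposite direction makes
    \<open>F n i m j\<close> and \<open>F m j n i\<close> disjoint. It takes nothing from the image
    of \<open>K n i\<close>, which misses \<open>E m j n i\<close>.\<close>
  define F where "F n i m j = (if K n i \<inter> K m j = {} then E n i m j - E m j n i else topspace Y)"
    for n i m j
  define H where "H n i = Y closure_of (f ` K n i) \<inter> (\<Inter>m. \<Inter>j. F n i m j)" for n i
  let ?Y = "sigma (topspace Y) {U. openin Y U}"
  have F: "F n i m j \<in> sets ?Y" for n i m j
  proof -
    have "topspace Y \<in> sets ?Y" by (simp add: sets_sigma_borel_sets_of openin_borel_sets_of)
    then show ?thesis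
      using E(1)[of n i m j] E(1)[of m j n i] unfolding F_def
      by (auto simp: Int_commute sets_sigma_borel_sets_of[symmetric])
  qed
  have fK: "f ` K n i \<subseteq> topspace Y" for n i
    using KP f by (auto simp: continuous_map_def X)
  have H: "H n i \<in> sets ?Y" for n i
  proof -
    have "Y closure_of (f ` K n i) \<in> sets ?Y"
      by (simp add: sets_sigma_borel_sets_of closedin_borel_sets_of)
    then show ?thesis unfolding H_def using F
      by (intro sets.Int sets.countable_INT) auto
  qed
  have fKH: "f ` K n i \<subseteq> H n i" for n i
  proof -
    have "f ` K n i \<subseteq> F n i m j" for m j
      using E(2)[of n i m j] E(3)[of m j n i] fK[of n i] unfolding F_def by (auto simp: Int_commute)
    moreover have "f ` K n i \<subseteq> Y closure_of (f ` K n i)" using fK by (rule closure_of_subset)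
    ultimately show ?thesis unfolding H_def by blast
  qed
  have meet: "K n i \<inter> K m j \<noteq> {}" if "y \<in> H n i" "y \<in> H m j" for y n i m j
  proof
    assume e: "K n i \<inter> K m j = {}"
    have "y \<in> F n i m j" "y \<in> F m j n i" using that unfolding H_def by auto
    then show False using e by (auto simp: F_def Int_commute)
  qed
  have "f ` P = (\<Inter>n. \<Union>i. H n i)"
  proof (intro equalityI subsetI)
    fix y assume "y \<in> f ` P"
    then obtain p where p: "p \<in> P" "y = f p" by blast
    have "\<exists>i. y \<in> H n i" for n using cover[of n] p fKH by blast
    then show "y \<in> (\<Inter>n. \<Union>i. H n i)" by blast
  next
    fix y assume "y \<in> (\<Inter>n. \<Union>i. H n i)"
    then have "\<forall>n. \<exists>i. y \<in> H n i" by blast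
    then obtain i where i: "\<And>n. y \<in> H n (i n)" by metis
    define r where "r n = 1 / real (Suc n)" for n
    have r: "r \<longlonglongrightarrow> 0" "\<And>n. r n > 0" "decseq r"
      using LIMSEQ_inverse_real_of_nat
      by (auto simp: r_def[abs_def] inverse_eq_divide decseq_def field_simps)
    have near: "d (c (i n)) (c (i m)) \<le> r n + r m" for n m
    proof -
      obtain x where "x \<in> K n (i n)" "x \<in> K m (i m)" using meet[OF i i] by blast
      then show ?thesis using triangle[of "c (i n)" x "c (i m)"]
        by (auto simp: K_def r_def commute)
    qed
    have "MCauchy (\<lambda>n. c (i n))" unfolding MCauchy_def
    proof (intro conjI allI impI)
      fix e :: real assume "e > 0"
      then obtain N where N: "\<And>n. n \<ge> N \<Longrightarrow> r n < e / 2"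
        using order_tendstoD(2)[OF r(1), of "e / 2"] by (auto simp: eventually_sequentially)
      have "d (c (i n)) (c (i m)) < e" if "N \<le> n" "N \<le> m" for n m
        using near[of n m] N[OF that(1)] N[OF that(2)] by linarith
      then show "\<exists>N. \<forall>n m. N \<le> n \<longrightarrow> N \<le> m \<longrightarrow> d (c (i n)) (c (i m)) < e" by blast
    qed (use cP in auto)
    then obtain p where p: "limitin mtopology (\<lambda>n. c (i n)) p sequentially"
      using complete unfolding mcomplete_def by blast
    then have pP: "p \<in> P" and lim: "(\<lambda>n. d (c (i n)) p) \<longlonglongrightarrow> 0"
      unfolding limitin_metric_dist_null by auto
    \<comment> \<open>Adjoining p provides the common point that
      \<open>continuous_map_eventually_small\<close> asks for, without having to show that p lies in
      the balls.\<close>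
    define C where "C n = insert p (K n (i n))" for n
    have dC: "d x z \<le> 2 * (r n + d (c (i n)) p)" if "x \<in> C n" "z \<in> C n" for n x z
    proof -
      have *: "x \<in> P \<and> d (c (i n)) x \<le> r n + d (c (i n)) p" if "x \<in> C n" for x
        using that pP r(2)[of n] by (auto simp: C_def K_def r_def add_increasing2)
      show ?thesis using *[OF that(1)] *[OF that(2)] triangle[of x "c (i n)" z] cP
        by (auto simp: commute)
    qed
    have blim: "(\<lambda>n. 2 * (r n + d (c (i n)) p)) \<longlonglongrightarrow> 0"
      using tendsto_mult_right_zero[OF tendsto_add_zero[OF r(1) lim]] .
    have "y = f p"
    proof (rule ccontr)
      assume "y \<noteq> f p"
      moreover have "y \<in> topspace Y"
        using i[of 0] unfolding H_def by (metis IntD1 in_closure_of)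
      moreover have "f p \<in> topspace Y" using f pP by (auto simp: continuous_map_def X)
      ultimately obtain V W where VW: "openin Y V" "openin Y W" "f p \<in> V" "y \<in> W" "disjnt V W"
        using Y unfolding Hausdorff_space_def by metis
      have C: "C n \<subseteq> P" "p \<in> C n" for n using KP pP by (auto simp: C_def)
      obtain N where "f ` C N \<subseteq> V"
        using continuous_map_eventually_small[where C = C, OF Pd f[unfolded X] C(1) dC blim pP C(2) VW(1,3)]
        by blast
      then have "f ` K N (i N) \<subseteq> V" by (auto simp: C_def)
      \<comment> \<open>This is the purpose of the closure in \<open>H\<close>: the neighbourhood W
        of y would have to meet the image of the ball, which lies in V.\<close>
      moreover have "y \<in> Y closure_of (f ` K N (i N))" using i[of N] by (simp add: H_def)
      ultimately show False using VW unfolding in_closure_of disjnt_def by blast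
    qed
    then show "y \<in> f ` P" using pP by blast
  qed
  moreover have "(\<Inter>n. \<Union>i. H n i) \<in> sets ?Y"
    using H by (intro sets.countable_INT sets.countable_UN) auto
  ultimately show ?thesis by (simp add: sets_sigma_borel_sets_of X)
qed

section \<open>The weak topology\<close>

text \<open>The sets are balls of radius 1/(n+1) around a dense sequence. Generation of the
  \<sigma>-algebra yields a countable measure-dense family; separation of points shows that an
  automorphism is determined by its action on sets.\<close>

lemma standard_borel_countable_base:
  assumes "standard_borel_space M"
  obtains U :: "nat \<Rightarrow> 'a set" where "\<And>i. U i \<in> sets M" "sets M = sigma_sets (space M) (range U)"
    "\<And>x y. x \<in> space M \<Longrightarrow> y \<in> space M \<Longrightarrow> x \<noteq> y \<Longrightarrow> \<exists>i. x \<in> U i \<and> y \<notin> U i"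
proof -
  obtain X where X: "Polish_space X" "topspace X = space M" "sets M = borel_sets_of X"
    using assms unfolding standard_borel_space_def by blast
  obtain P d where Pd: "Metric_space P d" and Xd: "X = Metric_space.mtopology P d"
    using X(1) unfolding Polish_space_def completely_metrizable_space_def by blast
  interpret Metric_space P d by fact
  have P: "P = space M" using X(2) Xd by simp
  obtain D where D: "countable D" "D \<subseteq> P" "mtopology closure_of D = P"
    using X(1) Xd unfolding Polish_space_def separable_space_def by auto
  \<comment> \<open>The default value keeps the enumerated set non-empty. If it lies outside P its
    balls are empty, otherwise they are balls like the others.\<close>
  define c where "c = from_nat_into (insert undefined D)"
  have c: "D \<subseteq> range c"
    unfolding c_def using D(1) by (subst range_from_nat_into) auto
  define U where "U k = (case prod_decode k of (i, n) \<Rightarrow> mball (c i) (1 / real (Suc n)))" for k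
  have small: "\<exists>k. x \<in> U k \<and> U k \<subseteq> mball x e" if x: "x \<in> P" and e: "e > 0" for x e
  proof -
    obtain n where "inverse (real (Suc n)) < e / 2"
      using reals_Archimedean[of "e / 2"] e by auto
    then have n: "1 / real (Suc n) < e / 2" by (simp add: inverse_eq_divide)
    have "x \<in> mtopology closure_of D" using D(3) x by simp
    then have "\<exists>y\<in>D. y \<in> mball x (1 / real (Suc n))"
      unfolding metric_closure_of by simp
    then obtain i where i: "c i \<in> mball x (1 / real (Suc n))" using c by blast
    have "x \<in> U (prod_encode (i, n))" using i by (auto simp: U_def commute)
    moreover have "U (prod_encode (i, n)) \<subseteq> mball x e"
    proof -
      have "d x (c i) + 1 / real (Suc n) \<le> e" using i n by auto
      then show ?thesis using mball_subset[of "c i" x "1 / real (Suc n)" e] x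
        by (simp add: U_def commute)
    qed
    ultimately show ?thesis by blast
  qed
  have openU: "openin X (U k)" for k by (auto simp: U_def Xd split: prod.split)
  have "sigma_sets (space M) {W. openin X W} = sigma_sets (space M) (range U)"
  proof (rule sigma_sets_eqI)
    fix W assume "W \<in> {W. openin X W}"
    then have W: "openin X W" by simp
    have "W \<subseteq> (\<Union>k\<in>{k. U k \<subseteq> W}. U k)"
    proof
      fix x assume x: "x \<in> W"
      then obtain e where "e > 0" "mball x e \<subseteq> W" and "x \<in> P"
        using W unfolding Xd openin_mtopology by blast
      with small[of x e] show "x \<in> (\<Union>k\<in>{k. U k \<subseteq> W}. U k)" by blast
    qed
    then have eq: "W = (\<Union>k\<in>{k. U k \<subseteq> W}. U k)" by blast
    interpret sigma_algebra "space M" "sigma_sets (space M) (range U)"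
      using openin_subset[OF openU] unfolding X(2) by (intro sigma_algebra_sigma_sets image_subsetI PowI)
    show "W \<in> sigma_sets (space M) (range U)"
      by (subst eq, rule countable_UN'') auto
  qed (use openU in auto)
  then have gen: "sets M = sigma_sets (space M) (range U)"
    using X(2,3) by (simp add: borel_sets_of_def)
  have inU: "U i \<in> sets M" for i using openU X(3) by (simp add: openin_borel_sets_of)
  have sep: "\<exists>i. x \<in> U i \<and> y \<notin> U i" if "x \<in> space M" "y \<in> space M" "x \<noteq> y" for x y
  proof -
    have "d x y > 0" using that P by simp
    from small[OF _ this] that P obtain k where "x \<in> U k" "U k \<subseteq> mball x (d x y)" by blast
    then show ?thesis by auto
  qed
  show ?thesis by (rule that[OF inU gen sep])
qed

text \<open>The union of all stages is the algebra generated by U. Building it in stages turns its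
  countability, for countable U, into an induction on n.\<close>

primrec algebra_stage :: "'a set \<Rightarrow> 'a set set \<Rightarrow> nat \<Rightarrow> 'a set set" where
  "algebra_stage X U 0 = insert {} U"
| "algebra_stage X U (Suc n) = algebra_stage X U n \<union> (\<lambda>A. X - A) ` algebra_stage X U n \<union>
     (\<lambda>(A, B). A \<union> B) ` (algebra_stage X U n \<times> algebra_stage X U n)"

lemma algebra_stage_mono: "m \<le> n \<Longrightarrow> algebra_stage X U m \<subseteq> algebra_stage X U n"
  by (induction n) (auto simp: le_Suc_eq)

text \<open>The sets that the generated algebra approximates in measure form a \<sigma>-algebra:
  symmetric differences are unchanged by complements and subadditive under unions, and a countable
  union is approximated by its finite subunions. It contains the generators, hence every measurable
  set.\<close>

lemma countable_dense_sets:
  assumes "prob_space M" "standard_borel_space M"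
  obtains A :: "nat \<Rightarrow> 'a set" where "\<And>k. A k \<in> sets M"
    "\<And>B e. B \<in> sets M \<Longrightarrow> e > 0 \<Longrightarrow> \<exists>k. measure M (sym_diff (A k) B) < e"
proof -
  interpret prob_space M by fact
  obtain U :: "nat \<Rightarrow> 'a set" where U: "\<And>i. U i \<in> sets M" "sets M = sigma_sets (space M) (range U)"
    using standard_borel_countable_base[OF assms(2)] by metis
  define F where "F = (\<Union>n. algebra_stage (space M) (range U) n)"
  have "countable (algebra_stage (space M) (range U) n)" for n
    by (induction n) auto
  then have countable_F: "countable F" by (simp add: F_def)
  have "algebra_stage (space M) (range U) n \<subseteq> sets M" for n
    by (induction n) (use U(1) in auto)
  then have F_sets: "A \<in> sets M" if "A \<in> F" for A using that by (auto simp: F_def)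
  have F_empty: "{} \<in> F" and UF: "U i \<in> F" for i by (auto simp: F_def intro!: exI[of _ 0])
  have F_compl: "space M - A \<in> F" if "A \<in> F" for A
  proof -
    obtain n where "A \<in> algebra_stage (space M) (range U) n" using \<open>A \<in> F\<close> by (auto simp: F_def)
    then have "space M - A \<in> algebra_stage (space M) (range U) (Suc n)" by simp
    then show ?thesis unfolding F_def by blast
  qed
  have F_Un: "A \<union> B \<in> F" if AB: "A \<in> F" "B \<in> F" for A B
  proof -
    obtain m n where "A \<in> algebra_stage (space M) (range U) m" "B \<in> algebra_stage (space M) (range U) n"
      using AB by (auto simp: F_def)
    then have "A \<in> algebra_stage (space M) (range U) (max m n)"
      "B \<in> algebra_stage (space M) (range U) (max m n)"
      using algebra_stage_mono[of m "max m n"] algebra_stage_mono[of n "max m n"] by force+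
    then have "A \<union> B \<in> algebra_stage (space M) (range U) (Suc (max m n))" by force
    then show ?thesis unfolding F_def by blast
  qed
  define Q where "Q B \<longleftrightarrow> B \<in> sets M \<and> (\<forall>e>0. \<exists>A\<in>F. measure M (sym_diff A B) < e)" for B
  have Q_Un: "Q (B \<union> C)" if BC: "Q B" "Q C" for B C
    unfolding Q_def
  proof (intro conjI allI impI)
    fix e :: real assume e: "e > 0"
    obtain S T where ST: "S \<in> F" "measure M (sym_diff S B) < e / 2"
      "T \<in> F" "measure M (sym_diff T C) < e / 2"
      using BC half_gt_zero[OF e] unfolding Q_def by blast
    have "measure M (sym_diff (S \<union> T) (B \<union> C)) \<le> measure M (sym_diff S B \<union> sym_diff T C)"
      using ST BC F_sets unfolding Q_def by (intro finite_measure_mono) auto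
    also have "\<dots> \<le> measure M (sym_diff S B) + measure M (sym_diff T C)"
      using ST BC F_sets unfolding Q_def by (intro measure_Un_le) auto
    also have "\<dots> < e" using ST by linarith
    finally show "\<exists>A\<in>F. measure M (sym_diff A (B \<union> C)) < e" using F_Un ST(1,3) by blast
  qed (use BC in \<open>auto simp: Q_def\<close>)
  have Q: "Q B" if "B \<in> sigma_sets (space M) (range U)" for B
    using that
  proof (induction rule: sigma_sets.induct)
    case (Basic B)
    then show ?case using U(1) UF by (auto simp: Q_def intro!: bexI[of _ B])
  next
    case Empty
    then show ?case using F_empty by (auto simp: Q_def intro!: bexI[of _ "{}"])
  next
    case (Compl B)
    show ?case unfolding Q_def
    proof (intro conjI allI impI)
      fix e :: real assume "e > 0"
      then obtain A where A: "A \<in> F" "measure M (sym_diff A B) < e"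
        using Compl.IH unfolding Q_def by blast
      have "sym_diff (space M - A) (space M - B) = sym_diff A B"
        using F_sets[OF A(1)] Compl.IH sets.sets_into_space unfolding Q_def by blast
      then show "\<exists>A\<in>F. measure M (sym_diff A (space M - B)) < e" using F_compl A by metis
    qed (use Compl.IH in \<open>auto simp: Q_def\<close>)
  next
    case (Union B)
    have meas: "B i \<in> sets M" for i using Union.IH by (simp add: Q_def)
    have fin: "Q (\<Union>i<n. B i)" for n
    proof (induction n)
      case 0
      show ?case using F_empty by (auto simp: Q_def intro!: bexI[of _ "{}"])
    next
      case (Suc n)
      then show ?case using Q_Un[OF Union.IH[of n] Suc] by (simp add: lessThan_Suc)
    qed
    show ?case unfolding Q_def
    proof (intro conjI allI impI)
      fix e :: real assume e: "e > 0"
      have "(\<lambda>n. measure M (\<Union>i<n. B i)) \<longlonglongrightarrow> measure M (\<Union>n. \<Union>i<n. B i)"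
        using meas by (intro finite_Lim_measure_incseq) (auto simp: incseq_def, force)
      moreover have "(\<Union>n. \<Union>i<n. B i) = (\<Union>i. B i)" by auto
      ultimately have "(\<lambda>n. measure M (\<Union>i<n. B i)) \<longlonglongrightarrow> measure M (\<Union>i. B i)" by simp
      then obtain n where n: "measure M (\<Union>i. B i) - e / 2 < measure M (\<Union>i<n. B i)"
        using order_tendstoD(1)[of _ _ sequentially "measure M (\<Union>i. B i) - e / 2"] e
        by (fastforce simp: eventually_sequentially)
      obtain A where A: "A \<in> F" "measure M (sym_diff A (\<Union>i<n. B i)) < e / 2"
        using fin[of n] e unfolding Q_def by (meson half_gt_zero)
      have "sym_diff (\<Union>i<n. B i) (\<Union>i. B i) = (\<Union>i. B i) - (\<Union>i<n. B i)" by auto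
      then have "measure M (sym_diff (\<Union>i<n. B i) (\<Union>i. B i)) =
          measure M (\<Union>i. B i) - measure M (\<Union>i<n. B i)"
        using meas by (simp only:) (intro finite_measure_Diff, auto)
      then have "measure M (sym_diff A (\<Union>i. B i)) < e"
        using measure_sym_diff_triangle[OF assms(1) F_sets[OF A(1)], of "\<Union>i<n. B i" "\<Union>i. B i"]
          meas A(2) n by (auto intro: sets.countable_UN)
      then show "\<exists>A\<in>F. measure M (sym_diff A (\<Union>i. B i)) < e" using A(1) by blast
    qed (use meas in auto)
  qed
  have range: "range (from_nat_into F) = F"
    using F_empty countable_F by (intro range_from_nat_into) auto
  show ?thesis
  proof (rule that[of "from_nat_into F"])
    show "from_nat_into F k \<in> sets M" for k using F_sets range by blast
    fix B and e :: real assume "B \<in> sets M" "e > 0"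
    then show "\<exists>k. measure M (sym_diff (from_nat_into F k) B) < e"
      using Q[of B] U(2) unfolding Q_def by (metis imageE range)
  qed
qed

section \<open>Pseudometrics for the weak topology\<close>

definition act_dist :: "'a measure \<Rightarrow> 'a set \<Rightarrow> ('a \<Rightarrow> 'a) set \<Rightarrow> ('a \<Rightarrow> 'a) set \<Rightarrow> real" where
  "act_dist M A S T = measure M (sym_diff ((SOME f. f \<in> S) ` A) ((SOME f. f \<in> T) ` A))"

lemma carrier_Aut: "carrier (Aut M) = {ae_class M f |f. f \<in> mp_bij M}"
  by (auto simp: Aut_def quotient_def)

lemma carrier_AutE:
  assumes "S \<in> carrier (Aut M)"
  obtains f where "f \<in> mp_bij M" "S = ae_class M f"
  using assms by (auto simp: carrier_Aut)

text \<open>Elements of \<open>Aut M\<close> are classes, so \<open>act_dist\<close> measures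
  arbitrarily chosen representatives; the choice does not matter because equivalent representatives
  map A to sets that agree up to a null set.\<close>

lemma act_dist_ae_class:
  assumes f: "f \<in> mp_bij M" and g: "g \<in> mp_bij M" and A: "A \<in> sets M"
  shows "act_dist M A (ae_class M f) (ae_class M g) = measure M (sym_diff (f ` A) (g ` A))"
proof -
  define f' g' where "f' = (SOME h. h \<in> ae_class M f)" and "g' = (SOME h. h \<in> ae_class M g)"
  have "f \<in> ae_class M f" "g \<in> ae_class M g" using f g by (auto simp: ae_eq_def)
  then have f': "(f, f') \<in> ae_eq M" and g': "(g, g') \<in> ae_eq M"
    unfolding f'_def g'_def by (metis Image_singleton_iff someI)+
  have mp: "f' \<in> mp_bij M" "g' \<in> mp_bij M" using f' g' by (auto simp: ae_eq_def)
  have "measure M (sym_diff (f' ` A) (g' ` A)) = measure M (sym_diff (f ` A) (g ` A))"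
  proof (rule measure_eq_AE)
    show "AE x in M. x \<in> sym_diff (f' ` A) (g' ` A) \<longleftrightarrow> x \<in> sym_diff (f ` A) (g ` A)"
      using ae_eq_image_null[OF f' A] ae_eq_image_null[OF g' A] by eventually_elim auto
  qed (use mp f g A in \<open>auto intro!: sets.Un sets.Diff mp_bij_image\<close>)
  then show ?thesis by (simp add: act_dist_def f'_def g'_def)
qed

lemma act_dist_nonneg: "0 \<le> act_dist M A S T"
  by (simp add: act_dist_def)

lemma act_dist_commute: "act_dist M A S T = act_dist M A T S"
  by (simp add: act_dist_def Un_commute)

lemma act_dist_refl [simp]: "act_dist M A S S = 0"
  by (simp add: act_dist_def)

lemma act_dist_le_1: "prob_space M \<Longrightarrow> act_dist M A S T \<le> 1"
  unfolding act_dist_def by (rule prob_space.prob_le_1)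

lemma act_dist_triangle:
  assumes "prob_space M" "S \<in> carrier (Aut M)" "T \<in> carrier (Aut M)" "U \<in> carrier (Aut M)"
    and A: "A \<in> sets M"
  shows "act_dist M A S U \<le> act_dist M A S T + act_dist M A T U"
proof -
  obtain f g h where "f \<in> mp_bij M" "S = ae_class M f" "g \<in> mp_bij M" "T = ae_class M g"
    "h \<in> mp_bij M" "U = ae_class M h"
    using assms(2-4) by (metis carrier_AutE)
  then show ?thesis
    using measure_sym_diff_triangle[OF assms(1), of "f ` A" "g ` A" "h ` A"] A
    by (simp add: act_dist_ae_class mp_bij_image(1))
qed

text \<open>Each of the two automorphisms carries the symmetric difference of A and B to a set of
  the same measure, whence the factor 2. This is how estimates pass from a dense sequence of sets to
  an arbitrary one.\<close>

lemma act_dist_change_set: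
  assumes M: "prob_space M" and S: "S \<in> carrier (Aut M)" and T: "T \<in> carrier (Aut M)"
    and AB: "A \<in> sets M" "B \<in> sets M"
  shows "act_dist M B S T \<le> act_dist M A S T + 2 * measure M (sym_diff A B)"
proof -
  obtain f g where f: "f \<in> mp_bij M" "S = ae_class M f" and g: "g \<in> mp_bij M" "T = ae_class M g"
    using S T by (metis carrier_AutE)
  have *: "measure M (sym_diff (h ` A) (h ` B)) = measure M (sym_diff A B)" if h: "h \<in> mp_bij M" for h
  proof -
    have "inj_on h (space M)" using mp_bijD(1)[OF h] by (simp add: bij_betw_def)
    moreover have "A \<subseteq> space M" "B \<subseteq> space M" using AB sets.sets_into_space by auto
    ultimately have "sym_diff (h ` A) (h ` B) = h ` sym_diff A B" by (auto simp: inj_on_def)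
    moreover have "measure M (h ` sym_diff A B) = measure M (sym_diff A B)"
      using AB by (intro mp_bij_image(2)[OF h]) auto
    ultimately show ?thesis by simp
  qed
  have sets: "f ` A \<in> sets M" "f ` B \<in> sets M" "g ` A \<in> sets M" "g ` B \<in> sets M"
    using f g AB by (auto intro: mp_bij_image)
  have "measure M (sym_diff (f ` B) (g ` B)) \<le>
      measure M (sym_diff (f ` B) (f ` A)) + measure M (sym_diff (f ` A) (g ` B))"
    using sets by (intro measure_sym_diff_triangle M)
  also have "measure M (sym_diff (f ` A) (g ` B)) \<le>
      measure M (sym_diff (f ` A) (g ` A)) + measure M (sym_diff (g ` A) (g ` B))"
    using sets by (intro measure_sym_diff_triangle M)
  finally show ?thesis
    using *[OF f(1)] *[OF g(1)] f g AB by (simp add: act_dist_ae_class Un_commute)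
qed

lemma openin_weak_topology_ball:
  assumes "T \<in> carrier (Aut M)" "A \<in> sets M" "e > 0"
  shows "openin (weak_topology M) {S \<in> carrier (Aut M). act_dist M A S T < e}"
proof -
  obtain g where g: "g \<in> mp_bij M" "T = ae_class M g" using assms(1) by (rule carrier_AutE)
  have "{S \<in> carrier (Aut M). act_dist M A S T < e} =
      {ae_class M f |f. f \<in> mp_bij M \<and> measure M (sym_diff (f ` A) (g ` A)) < e}"
    using g assms(2) by (auto simp: carrier_Aut act_dist_ae_class)
  then show ?thesis
    unfolding weak_topology_def
    by (intro topology_generated_by_Basis) (use g assms in blast)
qed

text \<open>Take for A the preimage under f of a base set \<open>U i\<close>. Then f maps A onto
  \<open>U i\<close>, so the hypothesis says that almost surely \<open>g x\<close> lies in
  \<open>U i\<close> if and only if x lies in A, that is, if and only if \<open>f x\<close> lies in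
  \<open>U i\<close>. The base separates points.\<close>

lemma Aut_eqI:
  assumes M: "standard_borel_space M" and S: "S \<in> carrier (Aut M)" and T: "T \<in> carrier (Aut M)"
    and fin: "finite_measure M" and *: "\<And>A. A \<in> sets M \<Longrightarrow> act_dist M A S T = 0"
  shows "S = T"
proof -
  interpret finite_measure M by fact
  obtain f g where f: "f \<in> mp_bij M" "S = ae_class M f" and g: "g \<in> mp_bij M" "T = ae_class M g"
    using S T by (metis carrier_AutE)
  obtain U :: "nat \<Rightarrow> 'a set" where U: "\<And>i. U i \<in> sets M"
    "\<And>x y. x \<in> space M \<Longrightarrow> y \<in> space M \<Longrightarrow> x \<noteq> y \<Longrightarrow> \<exists>i. x \<in> U i \<and> y \<notin> U i"
    using standard_borel_countable_base[OF M] by metis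
  have "AE x in M. f x \<in> U i \<longleftrightarrow> g x \<in> U i" for i
  proof -
    define A where "A = f -` U i \<inter> space M"
    have A: "A \<in> sets M" unfolding A_def by (rule measurable_sets[OF mp_bijD(2)[OF f(1)] U(1)])
    have im: "f ` A \<in> sets M" "g ` A \<in> sets M" using f g A by (auto intro: mp_bij_image)
    have "measure M (sym_diff (f ` A) (g ` A)) = 0"
      using *[OF A] f g A by (simp add: act_dist_ae_class)
    then have "sym_diff (f ` A) (g ` A) \<in> null_sets M"
      using im by (auto simp: null_sets_def emeasure_eq_measure)
    then have "AE x in M. x \<notin> sym_diff (f ` A) (g ` A)" by (rule AE_not_in)
    then have "AE x in M. g x \<notin> sym_diff (f ` A) (g ` A)" by (rule mp_bij_AE[OF g(1)])
    then show ?thesis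
    proof (rule AE_mp, intro AE_I2 impI)
      fix x assume x: "x \<in> space M" and n: "g x \<notin> sym_diff (f ` A) (g ` A)"
      have AM: "A \<subseteq> space M" by (simp add: A_def)
      have fb: "bij_betw f (space M) (space M)" and gb: "bij_betw g (space M) (space M)"
        using f g by (auto dest: mp_bijD)
      have "f ` A = U i"
        using fb sets.sets_into_space[OF U(1)[of i]]
        by (force simp: A_def bij_betw_def)
      moreover have "g x \<in> g ` A \<longleftrightarrow> x \<in> A"
        using gb AM x by (auto simp: bij_betw_def inj_on_def)
      ultimately show "f x \<in> U i \<longleftrightarrow> g x \<in> U i" using n x by (auto simp: A_def)
    qed
  qed
  then have "AE x in M. \<forall>i. f x \<in> U i \<longleftrightarrow> g x \<in> U i" by (simp add: AE_all_countable)
  then have "AE x in M. f x = g x"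
  proof (rule AE_mp, intro AE_I2 impI)
    fix x assume "x \<in> space M" "\<forall>i. f x \<in> U i \<longleftrightarrow> g x \<in> U i"
    moreover have "f x \<in> space M" "g x \<in> space M" if "x \<in> space M"
      using that f g by (auto dest!: mp_bijD(1) simp: bij_betw_apply)
    ultimately show "f x = g x" using U(2) by metis
  qed
  then show ?thesis using f g by (simp add: ae_class_eq_iff)
qed

lemma Hausdorff_weak_topology:
  assumes "prob_space M" "standard_borel_space M"
  shows "Hausdorff_space (weak_topology M)"
proof -
  interpret prob_space M by fact
  have "\<exists>U V. openin (weak_topology M) U \<and> openin (weak_topology M) V \<and>
      S \<in> U \<and> T \<in> V \<and> disjnt U V"
    if ST: "S \<in> carrier (Aut M)" "T \<in> carrier (Aut M)" "S \<noteq> T" for S T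
  proof -
    obtain A where A: "A \<in> sets M" "act_dist M A S T \<noteq> 0"
      using Aut_eqI[OF assms(2) ST(1,2) finite_measure_axioms] ST(3) by blast
    define e where "e = act_dist M A S T / 2"
    have e: "e > 0" using A(2) act_dist_nonneg[of M A S T] by (simp add: e_def)
    let ?V = "\<lambda>T. {S \<in> carrier (Aut M). act_dist M A S T < e}"
    have "disjnt (?V S) (?V T)"
      unfolding disjnt_iff
    proof (intro allI notI)
      fix R assume "R \<in> ?V S \<and> R \<in> ?V T"
      then show False
        using act_dist_triangle[OF assms(1) ST(1) _ ST(2) A(1), of R]
        by (simp add: e_def act_dist_commute[of M A S R])
    qed
    moreover have "S \<in> ?V S" "T \<in> ?V T" using ST e by auto
    ultimately show ?thesis
      using openin_weak_topology_ball[OF ST(1) A(1) e] openin_weak_topology_ball[OF ST(2) A(1) e]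
      by blast
  qed
  then show ?thesis by (simp add: Hausdorff_space_def topspace_weak_topology)
qed

section \<open>Full groups\<close>

lemma mp_bij_inv_simps:
  assumes "f \<in> mp_bij M"
  shows "x \<in> space M \<Longrightarrow> f x \<in> space M"
    "x \<in> space M \<Longrightarrow> inv_into (space M) f x \<in> space M"
    "x \<in> space M \<Longrightarrow> inv_into (space M) f (f x) = x"
    "x \<in> space M \<Longrightarrow> f (inv_into (space M) f x) = x"
  using mp_bijD(1)[OF assms]
  by (auto simp: bij_betw_apply bij_betw_inv_into_left bij_betw_inv_into_right
      bij_betw_apply[OF bij_betw_inv_into])

lemma mp_bij_inj: "f \<in> mp_bij M \<Longrightarrow> inj_on f (space M)"
  by (auto dest: mp_bijD(1) simp: bij_betw_def)

lemma inv_ae_class: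
  assumes f: "f \<in> mp_bij M"
  shows "inv\<^bsub>Aut M\<^esub> (ae_class M f) = ae_class M (inv_into (space M) f)"
proof -
  interpret group "Aut M" by (rule group_Aut)
  have "AE x in M. (inv_into (space M) f \<circ> f) x = id x"
    by (rule AE_I2) (simp add: mp_bij_inv_simps[OF f])
  then have "ae_class M (inv_into (space M) f \<circ> f) = ae_class M id"
    using f by (subst ae_class_eq_iff) (auto intro: mp_bij_comp mp_bij_inv mp_bij_id)
  then have "ae_class M (inv_into (space M) f) \<otimes>\<^bsub>Aut M\<^esub> ae_class M f = \<one>\<^bsub>Aut M\<^esub>"
    using Aut_mult[OF mp_bij_inv[OF f] f] by (simp add: Aut_def)
  then show ?thesis
    using f mp_bij_inv[OF f] by (intro inv_equality) (auto simp: carrier_Aut)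
qed

lemma subgroup_ae_class:
  assumes "subgroup G (Aut M)"
  shows "f \<in> mp_bij M \<Longrightarrow> g \<in> mp_bij M \<Longrightarrow> ae_class M f \<in> G \<Longrightarrow> ae_class M g \<in> G \<Longrightarrow>
      ae_class M (f \<circ> g) \<in> G"
    and "f \<in> mp_bij M \<Longrightarrow> ae_class M f \<in> G \<Longrightarrow> ae_class M (inv_into (space M) f) \<in> G"
    and "ae_class M id \<in> G"
  using subgroup.m_closed[OF assms, of "ae_class M f" "ae_class M g"] Aut_mult[of f M g]
    subgroup.m_inv_closed[OF assms, of "ae_class M f"] inv_ae_class[of f M]
    subgroup.one_closed[OF assms]
  by (auto simp: Aut_def)

lemma mp_bij_image_inv:
  assumes f: "f \<in> mp_bij M" and A: "A \<subseteq> space M"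
  shows "inv_into (space M) f ` (f ` A) = A" "f ` (inv_into (space M) f ` A) = A"
  using mp_bij_inv_simps[OF f] A by (force simp: image_image subset_iff)+

section \<open>Involutions exchanging a set with a disjoint translate\<close>

definition swap_along :: "'a measure \<Rightarrow> ('a \<Rightarrow> 'a) \<Rightarrow> 'a set \<Rightarrow> 'a \<Rightarrow> 'a" where
  "swap_along M f D x = (if x \<in> D then f x else if x \<in> f ` D then inv_into (space M) f x else x)"

lemma swap_along_simps:
  assumes f: "f \<in> mp_bij M" and D: "D \<subseteq> space M" "D \<inter> f ` D = {}"
  shows "x \<in> D \<Longrightarrow> swap_along M f D x = f x" "x \<in> D \<Longrightarrow> swap_along M f D (f x) = x"
    "x \<notin> D \<Longrightarrow> x \<notin> f ` D \<Longrightarrow> swap_along M f D x = x"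
  using mp_bij_inv_simps(3)[OF f, of x] D by (auto simp: swap_along_def)

text \<open>The map is an involution of the space, hence its own inverse, which settles bijectivity
  and measurability of the inverse. For the measure, a set is cut along D, its translate and the
  rest; the preimages of the three parts are images under the inverse of f, under f and under the
  identity.\<close>

lemma swap_along_mp_bij:
  assumes M: "prob_space M" and f: "f \<in> mp_bij M" and D: "D \<in> sets M" "D \<inter> f ` D = {}"
  shows "swap_along M f D \<in> mp_bij M"
proof -
  interpret prob_space M by fact
  let ?s = "swap_along M f D" and ?h = "inv_into (space M) f"
  have DM: "D \<subseteq> space M" by (rule sets.sets_into_space[OF D(1)])
  note simps = swap_along_simps[OF f DM D(2)]
  have fD: "f ` D \<in> sets M" by (rule mp_bij_image(1)[OF f D(1)])
  have inv: "?s x \<in> space M \<and> ?s (?s x) = x" if x: "x \<in> space M" for x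
  proof (cases "x \<in> D \<or> x \<in> f ` D")
    case True
    then show ?thesis using simps(1,2) DM mp_bij_inv_simps(1)[OF f] x by auto
  next
    case False
    then show ?thesis using simps(3)[of x] x by simp
  qed
  have bij: "bij_betw ?s (space M) (space M)"
    by (rule bij_betw_byWitness[of _ ?s]) (use inv in auto)
  have meas: "?s \<in> measurable M M"
    unfolding swap_along_def
    by (intro measurable_If_set mp_bijD(2,3)[OF f] measurable_ident_sets refl)
      (use D fD sets.sets_into_space[OF fD] DM in \<open>auto simp: Int_absorb1 Int_absorb2\<close>)
  have "inv_into (space M) ?s \<in> measurable M M \<longleftrightarrow> ?s \<in> measurable M M"
  proof (rule measurable_cong)
    fix x assume "x \<in> space M"
    then show "inv_into (space M) ?s x = ?s x"
      using inv[of x] bij_betw_inv_into_left[OF bij, of "?s x"] by simp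
  qed
  moreover have "distr M M ?s = M"
  proof (rule measure_eqI)
    fix B assume "B \<in> sets (distr M M ?s)"
    then have B: "B \<in> sets M" by simp
    then have BM: "B \<subseteq> space M" by (rule sets.sets_into_space)
    let ?X = "?h ` (B \<inter> f ` D)" and ?Y = "f ` (B \<inter> D)" and ?Z = "B - D - f ` D"
    have "?s -` B \<inter> space M = ?X \<union> ?Y \<union> ?Z" (is "?L = ?R")
    proof (intro equalityI subsetI)
      fix x assume x: "x \<in> ?L"
      consider "x \<in> D" | "x \<in> f ` D" | "x \<notin> D" "x \<notin> f ` D" by blast
      then show "x \<in> ?R"
      proof cases
        case 1
        then have "f x \<in> B \<inter> f ` D" "x = ?h (f x)"
          using simps(1)[of x] x mp_bij_inv_simps(3)[OF f] by auto
        then show ?thesis by blast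
      next
        case 2
        then obtain y where "y \<in> D" "x = f y" by blast
        then show ?thesis using simps(2)[of y] x by auto
      qed (use simps(3)[of x] x in auto)
    next
      fix x assume "x \<in> ?R"
      then consider y where "y \<in> D" "f y \<in> B" "x = ?h (f y)" | y where "y \<in> B" "y \<in> D" "x = f y"
        | "x \<in> B" "x \<notin> D" "x \<notin> f ` D" by blast
      then show "x \<in> ?L"
      proof cases
        case 1
        then have "x = y" using DM mp_bij_inv_simps(3)[OF f, of y] by auto
        then show ?thesis using 1 simps(1)[of y] DM by auto
      next
        case 2
        then show ?thesis using simps(2)[of y] DM mp_bij_inv_simps(1)[OF f] by auto
      next
        case 3
        then show ?thesis using simps(3)[of x] BM by auto
      qed
    qed
    moreover have "measure M (?X \<union> ?Y \<union> ?Z) = measure M ?X + measure M ?Y + measure M ?Z"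
    proof -
      have "?X \<subseteq> D" "?Y \<subseteq> f ` D" using DM mp_bij_inv_simps(3)[OF f] by auto
      moreover have "?X \<in> sets M" "?Y \<in> sets M" "?Z \<in> sets M"
        using B D fD mp_bij_inv[OF f] f by (auto intro: mp_bij_image)
      ultimately show ?thesis
        using D(2) by (subst finite_measure_Union, auto)+
    qed
    moreover have "measure M ?X = measure M (B \<inter> f ` D)"
      using B fD by (intro mp_bij_image(2)[OF mp_bij_inv[OF f]]) auto
    moreover have "measure M ?Y = measure M (B \<inter> D)"
      using B D(1) by (intro mp_bij_image(2)[OF f]) auto
    moreover have "measure M B = measure M (B \<inter> f ` D) + measure M (B \<inter> D) + measure M ?Z"
    proof -
      have "B = (B \<inter> f ` D) \<union> (B \<inter> D) \<union> ?Z" by blast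
      moreover have "measure M ((B \<inter> f ` D) \<union> (B \<inter> D) \<union> ?Z) =
          measure M (B \<inter> f ` D) + measure M (B \<inter> D) + measure M ?Z"
        using B D fD by (subst finite_measure_Union, auto)+
      ultimately show ?thesis by simp
    qed
    ultimately have "measure M (?s -` B \<inter> space M) = measure M B" by simp
    then show "emeasure (distr M M ?s) B = emeasure M B"
      using B meas by (simp add: emeasure_distr emeasure_eq_measure)
  qed simp
  ultimately show ?thesis using bij meas by (simp add: mp_bij_def)
qed

text \<open>This is where cutting and pasting enters: f on D, its inverse on the translate, the
  identity elsewhere. Empty sets pad the three pieces to a partition indexed by the natural
  numbers.\<close>

lemma swap_along_full_group:
  assumes M: "prob_space M" and G: "full_group M G"
    and f: "f \<in> mp_bij M" "ae_class M f \<in> G" and D: "D \<in> sets M" "D \<inter> f ` D = {}"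
  shows "ae_class M (swap_along M f D) \<in> G"
proof -
  have sub: "subgroup G (Aut M)" using G by (simp add: full_group_def)
  let ?h = "inv_into (space M) f"
  define t where "t n = (if n = 0 then f else if n = 1 then ?h else id)" for n :: nat
  define A where "A n = (if n = 0 then D else if n = 1 then f ` D
    else if n = 2 then space M - D - f ` D else {})" for n :: nat
  have fD: "f ` D \<in> sets M" by (rule mp_bij_image(1)[OF f(1) D(1)])
  have "t n \<in> mp_bij M \<and> ae_class M (t n) \<in> G" for n
    using f mp_bij_inv[OF f(1)] subgroup_ae_class(2,3)[OF sub] by (simp add: t_def mp_bij_id)
  moreover have "A n \<in> sets M" for n using D fD by (auto simp: A_def)
  moreover have "disjoint_family A" using D(2) by (auto simp: disjoint_family_on_def A_def)
  moreover have "(\<Union>n. A n) = space M"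
  proof (intro equalityI subsetI)
    fix x assume "x \<in> space M"
    then have "x \<in> A 0 \<union> A 1 \<union> A 2" by (auto simp: A_def)
    then show "x \<in> (\<Union>n. A n)" by blast
  qed (use sets.sets_into_space[OF D(1)] sets.sets_into_space[OF fD] in
      \<open>auto simp: A_def split: if_splits\<close>)
  moreover have "AE x in M. x \<in> A n \<longrightarrow> swap_along M f D x = t n x" for n
    using D(2) by (intro AE_I2) (auto simp: A_def t_def swap_along_def)
  ultimately show ?thesis
    using G swap_along_mp_bij[OF M f(1) D] unfolding full_group_def by blast
qed

text \<open>A set of maximal measure among those whose translates all avoid \<open>B\<close> is invariant.\<close>

lemma ergodic_translate_meets:
  assumes M: "prob_space M" and sub: "subgroup G (Aut M)" and erg: "ergodic M G"
    and A: "A \<in> sets M" "measure M A > 0" and B: "B \<in> sets M" "measure M B > 0"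
  shows "\<exists>f\<in>mp_bij M. ae_class M f \<in> G \<and> measure M (f ` A \<inter> B) > 0"
proof (rule ccontr)
  assume neg: "\<not> ?thesis"
  interpret prob_space M by fact
  define F where "F = {E\<in>sets M. \<forall>f\<in>mp_bij M. ae_class M f \<in> G \<longrightarrow> f ` E \<inter> B \<in> null_sets M}"
  have "measure M (f ` A \<inter> B) = 0" if "f \<in> mp_bij M" "ae_class M f \<in> G" for f
    using neg that by (metis zero_less_measure_iff)
  then have AF: "A \<in> F"
    using A(1) B(1) by (auto simp: F_def null_sets_def emeasure_eq_measure mp_bij_image)
  have UN: "(\<Union>n. E n) \<in> F" if E: "\<And>n. E n \<in> F" for E :: "nat \<Rightarrow> 'a set"
  proof -
    have "f ` (\<Union>n. E n) \<inter> B \<in> null_sets M" if f: "f \<in> mp_bij M" "ae_class M f \<in> G" for f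
    proof -
      have "(\<Union>n. f ` E n \<inter> B) \<in> null_sets M"
        using E f by (intro null_sets_UN) (auto simp: F_def)
      then show ?thesis by (simp add: image_UN)
    qed
    then show ?thesis using E by (auto simp: F_def)
  qed
  have img: "g ` E \<in> F" if E: "E \<in> F" and g: "g \<in> mp_bij M" "ae_class M g \<in> G" for E g
  proof -
    have "f ` (g ` E) \<inter> B \<in> null_sets M" if f: "f \<in> mp_bij M" "ae_class M f \<in> G" for f
      unfolding image_comp
      using E mp_bij_comp[OF f(1) g(1)] subgroup_ae_class(1)[OF sub f(1) g(1) f(2) g(2)]
      by (simp add: F_def del: comp_apply o_apply)
    then show ?thesis using E g mp_bij_image(1) by (auto simp: F_def)
  qed
  define s where "s = (SUP E\<in>F. measure M E)"
  have bdd: "bdd_above (measure M ` F)" by (rule bdd_aboveI2[of _ _ 1]) simp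
  have le_s: "measure M E \<le> s" if "E \<in> F" for E
    unfolding s_def by (rule cSUP_upper[OF that bdd])
  have "\<exists>E\<in>F. s - 1 / real (Suc n) < measure M E" for n
  proof -
    have "s - 1 / real (Suc n) < (SUP E\<in>F. measure M E)" by (simp add: s_def)
    then show ?thesis using AF bdd by (subst (asm) less_cSUP_iff) auto
  qed
  then obtain E where E: "\<And>n. E n \<in> F" "\<And>n. s - 1 / real (Suc n) < measure M (E n)" by metis
  define W where "W = (\<Union>n. E n)"
  have W: "W \<in> F" unfolding W_def by (rule UN[OF E(1)])
  then have Ws: "W \<in> sets M" by (simp add: F_def)
  have "s \<le> measure M W"
  proof (rule LIMSEQ_le_const2)
    show "(\<lambda>n. s - 1 / real (Suc n)) \<longlonglongrightarrow> s"
      using tendsto_diff[OF tendsto_const LIMSEQ_inverse_real_of_nat, of s]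
      by (simp add: inverse_eq_divide)
    have "s - 1 / real (Suc n) \<le> measure M W" for n
    proof -
      have "measure M (E n) \<le> measure M W"
        by (rule finite_measure_mono[OF _ Ws]) (auto simp: W_def)
      then show ?thesis using E(2)[of n] by linarith
    qed
    then show "\<exists>N. \<forall>n\<ge>N. s - 1 / real (Suc n) \<le> measure M W" by blast
  qed
  then have max: "measure M E \<le> measure M W" if "E \<in> F" for E using le_s[OF that] by simp
  have "measure M (sym_diff W (g ` W)) = 0" if g: "g \<in> mp_bij M" "ae_class M g \<in> G" for g
  proof -
    have gW: "g ` W \<in> sets M" "measure M (g ` W) = measure M W"
      using mp_bij_image[OF g(1) Ws] by auto
    \<comment> \<open>The union of W with its translate stays in F, so by maximality the translate
      has no mass outside W. Both sets have the same measure, so the opposite difference is null as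
      well.\<close>
    have "(\<Union>n::nat. if n = 0 then W else g ` W) \<in> F"
      by (rule UN) (use W img[OF W g] in auto)
    moreover have "(\<Union>n::nat. if n = 0 then W else g ` W) = W \<union> g ` W"
      by (auto split: if_splits)
    ultimately have "measure M (W \<union> g ` W) \<le> measure M W" using max by simp
    then have "measure M (g ` W - W) \<le> 0" and "measure M (W - g ` W) \<le> 0"
      using finite_measure_Union'[of W "g ` W"] finite_measure_Union'[of "g ` W" W] Ws gW
      by (auto simp: Un_commute)
    moreover have "measure M (sym_diff W (g ` W)) \<le> measure M (W - g ` W) + measure M (g ` W - W)"
      using Ws gW by (intro measure_Un_le) auto
    ultimately show ?thesis using measure_nonneg[of M "sym_diff W (g ` W)"] by linarith
  qed
  moreover have "g \<in> mp_bij M \<and> ae_class M g \<in> G" if "S \<in> G" "g \<in> S" for S g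
  proof -
    have "S \<in> carrier (Aut M)" using that(1) subgroup.subset[OF sub] by (rule subsetD[rotated])
    then obtain f where f: "f \<in> mp_bij M" "S = ae_class M f" by (rule carrier_AutE)
    have "(f, g) \<in> ae_eq M" using that(2) f(2) by simp
    then have "g \<in> mp_bij M" "ae_class M f = ae_class M g"
      using f(1) by (auto simp: ae_eq_def ae_class_eq_iff)
    then show ?thesis using f that by simp
  qed
  ultimately have "measure M W = 0 \<or> measure M W = 1"
    using erg Ws unfolding ergodic_def by blast
  \<comment> \<open>The set A belongs to F, so W has positive and therefore full measure. The
    identity is one of the translations, so W meets B in a null set, against
    \<open>measure M B > 0\<close>.\<close>
  then have "measure M W = 1" using max[OF AF] A(2) by auto
  moreover have "W \<inter> B \<in> null_sets M"
    using W mp_bij_id subgroup_ae_class(3)[OF sub] by (fastforce simp: F_def)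
  then have "measure M (W \<inter> B) = 0" by (simp add: measure_def null_setsD1)
  ultimately show False
    using prob_compl[OF Ws] finite_measure_mono[of "B - W" "space M - W"]
      finite_measure_Diff'[OF B(1) Ws] B Ws sets.sets_into_space[OF B(1)]
    by (auto simp: Int_commute)
qed

text \<open>Non-atomicity cuts C into three pieces of positive measure, and ergodicity finds
  \<open>F1\<close>, \<open>F2\<close>, \<open>F3\<close> in them, where f maps \<open>F1\<close>
  onto \<open>F2\<close> and h maps \<open>F2\<close> onto \<open>F3\<close>. The involutions u and
  v exchange the first two and the last two, like the transpositions (1 2) and (2 3): on
  \<open>F1\<close>, applying v first gives \<open>f x\<close>, applying u first gives
  \<open>h (f x)\<close>.\<close>

lemma full_group_local_noncommuting:
  assumes M: "standard_prob_space M" and G: "full_group M G" and erg: "ergodic M G"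
    and C: "C \<in> sets M" "measure M C > 0"
  shows "\<exists>u v. u \<in> mp_bij M \<and> v \<in> mp_bij M \<and> ae_class M u \<in> G \<and> ae_class M v \<in> G \<and>
    (\<forall>x. x \<notin> C \<longrightarrow> u x = x \<and> v x = x) \<and> ae_class M (u \<circ> v) \<noteq> ae_class M (v \<circ> u)"
proof -
  have ps: "prob_space M" and na: "non_atomic M" using M by (auto simp: standard_prob_space_def)
  interpret prob_space M by fact
  have sub: "subgroup G (Aut M)" using G by (simp add: full_group_def)
  have split: "\<exists>E\<in>sets M. E \<subseteq> D \<and> measure M E > 0 \<and> measure M (D - E) > 0"
    if D: "D \<in> sets M" "measure M D > 0" for D
  proof -
    obtain E where E: "E \<in> sets M" "E \<subseteq> D" "0 < emeasure M E" "emeasure M E < emeasure M D"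
      using na D unfolding non_atomic_def by (auto simp: emeasure_eq_measure)
    then show ?thesis
      using D by (intro bexI[of _ E])
        (auto simp: emeasure_eq_measure finite_measure_Diff ennreal_less_iff)
  qed
  obtain C1 where C1: "C1 \<in> sets M" "C1 \<subseteq> C" "measure M C1 > 0" "measure M (C - C1) > 0"
    using split[OF C] by blast
  obtain C2 where C2: "C2 \<in> sets M" "C2 \<subseteq> C - C1" "measure M C2 > 0" "measure M (C - C1 - C2) > 0"
    using split[of "C - C1"] C1 C by blast
  define C3 where "C3 = C - C1 - C2"
  have C3: "C3 \<in> sets M" "measure M C3 > 0" using C C1 C2 by (auto simp: C3_def)
  obtain f where f: "f \<in> mp_bij M" "ae_class M f \<in> G" "measure M (f ` C1 \<inter> C2) > 0"
    using ergodic_translate_meets[OF ps sub erg C1(1,3) C2(1,3)] by blast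
  define E2 where "E2 = f ` C1 \<inter> C2"
  have E2: "E2 \<in> sets M" "measure M E2 > 0"
    using f C1 C2 by (auto simp: E2_def mp_bij_image)
  obtain h where h: "h \<in> mp_bij M" "ae_class M h \<in> G" "measure M (h ` E2 \<inter> C3) > 0"
    using ergodic_translate_meets[OF ps sub erg E2 C3] by blast
  let ?f' = "inv_into (space M) f" and ?h' = "inv_into (space M) h"
  \<comment> \<open>The sets are pulled back from the last piece, so that f and h map each of them
    exactly onto the next one.\<close>
  define F3 F2 F1 where "F3 = h ` E2 \<inter> C3" and "F2 = ?h' ` F3" and "F1 = ?f' ` F2"
  have F3: "F3 \<in> sets M" "measure M F3 > 0"
    using h E2(1) C3(1) by (auto simp: F3_def intro!: mp_bij_image)
  have F2: "F2 \<in> sets M" "measure M F2 > 0"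
    using mp_bij_image[OF mp_bij_inv[OF h(1)] F3(1)] F3(2) by (simp_all add: F2_def)
  have F1: "F1 \<in> sets M" "measure M F1 > 0"
    using mp_bij_image[OF mp_bij_inv[OF f(1)] F2(1)] F2(2) by (simp_all add: F1_def)
  note F = F3(1) F2(1) F1
  note sp = sets.sets_into_space
  have fF1: "f ` F1 = F2" and hF2: "h ` F2 = F3"
    using mp_bij_image_inv(2)[OF f(1) sp[OF F(2)]] mp_bij_image_inv(2)[OF h(1) sp[OF F(1)]]
    by (auto simp: F1_def F2_def)
  have "F2 \<subseteq> ?h' ` (h ` E2)" "F3 \<subseteq> C3" by (auto simp: F2_def F3_def)
  then have F2E: "F2 \<subseteq> E2" using mp_bij_image_inv(1)[OF h(1) sp[OF E2(1)]] by simp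
  then have "F1 \<subseteq> ?f' ` (f ` C1)" by (auto simp: F1_def E2_def)
  then have F1C: "F1 \<subseteq> C1" using mp_bij_image_inv(1)[OF f(1) sp[OF C1(1)]] by simp
  have disj: "F1 \<inter> F2 = {}" "F2 \<inter> F3 = {}" "F1 \<inter> F3 = {}" and FC: "F1 \<subseteq> C" "F2 \<subseteq> C" "F3 \<subseteq> C"
    using F1C F2E \<open>F3 \<subseteq> C3\<close> C1 C2 by (auto simp: E2_def C3_def)
  have D1: "F1 \<inter> f ` F1 = {}" and D2: "F2 \<inter> h ` F2 = {}" using disj by (auto simp: fF1 hF2)
  define u v where "u = swap_along M f F1" and "v = swap_along M h F2"
  have uv: "u \<in> mp_bij M" "v \<in> mp_bij M" "ae_class M u \<in> G" "ae_class M v \<in> G"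
    using swap_along_mp_bij[OF ps f(1) F(3) D1] swap_along_mp_bij[OF ps h(1) F(2) D2]
      swap_along_full_group[OF ps G f(1,2) F(3) D1] swap_along_full_group[OF ps G h(1,2) F(2) D2]
    by (auto simp: u_def v_def)
  note us = swap_along_simps[OF f(1) sp[OF F(3)] D1, folded u_def, unfolded fF1]
  note vs = swap_along_simps[OF h(1) sp[OF F(2)] D2, folded v_def, unfolded hF2]
  have supp: "u x = x \<and> v x = x" if "x \<notin> C" for x
    using us(3)[of x] vs(3)[of x] that FC by auto
  have "ae_class M (u \<circ> v) \<noteq> ae_class M (v \<circ> u)"
  proof
    assume "ae_class M (u \<circ> v) = ae_class M (v \<circ> u)"
    then have "AE x in M. (u \<circ> v) x = (v \<circ> u) x"
      using uv by (simp add: ae_class_eq_iff mp_bij_comp)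
    moreover have "(u \<circ> v) x \<noteq> (v \<circ> u) x" if x: "x \<in> F1" for x
    proof -
      have "f x \<in> F2" using x fF1 by blast
      then have "h (f x) \<in> F3" using hF2 by blast
      moreover have "x \<notin> F2" "x \<notin> F3" using x disj by auto
      then have "(u \<circ> v) x = f x" using us(1)[OF x] vs(3)[of x] by simp
      moreover have "(v \<circ> u) x = h (f x)" using us(1)[OF x] vs(1)[OF \<open>f x \<in> F2\<close>] by simp
      ultimately show ?thesis using disj(2) \<open>f x \<in> F2\<close> by auto
    qed
    ultimately have "AE x in M. x \<notin> F1" by (auto elim: eventually_mono)
    then have "F1 \<in> null_sets M" using F(3) by (simp add: AE_iff_null_sets)
    then have "measure M F1 = 0" by (simp add: measure_def null_setsD1)
    then show False using F(4) by simp
  qed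
  then show ?thesis using uv supp by blast
qed

section \<open>Disjointness of images as a commutation condition\<close>

definition supported_in :: "'a measure \<Rightarrow> ('a \<Rightarrow> 'a) set set \<Rightarrow> 'a set \<Rightarrow> ('a \<Rightarrow> 'a) set set" where
  "supported_in M G A =
     {ae_class M u |u. u \<in> mp_bij M \<and> ae_class M u \<in> G \<and> (\<forall>x\<in>space M - A. u x = x)}"

text \<open>If u is supported in A, then its conjugate by t is supported in the image of A, and maps
  whose supports meet in a null set commute almost everywhere. Conversely, if the image of A meets B
  in positive measure, take non-commuting w and v supported in the intersection: the conjugate of w
  by the inverse of t is supported in A, and conjugating it back by t gives w.\<close>

lemma image_disjoint_iff_commute:
  assumes M: "standard_prob_space M" and G: "full_group M G" and erg: "ergodic M G"
    and t: "t \<in> mp_bij M" "ae_class M t \<in> G" and A: "A \<in> sets M" and B: "B \<in> sets M"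
  shows "measure M (t ` A \<inter> B) = 0 \<longleftrightarrow>
    (\<forall>U\<in>supported_in M G A. \<forall>V\<in>supported_in M G B.
      ae_class M t \<otimes>\<^bsub>Aut M\<^esub> U \<otimes>\<^bsub>Aut M\<^esub> inv\<^bsub>Aut M\<^esub> (ae_class M t) \<otimes>\<^bsub>Aut M\<^esub> V =
      V \<otimes>\<^bsub>Aut M\<^esub> (ae_class M t \<otimes>\<^bsub>Aut M\<^esub> U \<otimes>\<^bsub>Aut M\<^esub> inv\<^bsub>Aut M\<^esub> (ae_class M t)))"
    (is "?L \<longleftrightarrow> ?R")
proof -
  have ps: "prob_space M" using M by (simp add: standard_prob_space_def)
  interpret prob_space M by fact
  have sub: "subgroup G (Aut M)" using G by (simp add: full_group_def)
  let ?t' = "inv_into (space M) t"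
  have t': "?t' \<in> mp_bij M" by (rule mp_bij_inv[OF t(1)])
  have tA: "t ` A \<in> sets M" by (rule mp_bij_image(1)[OF t(1) A])
  note ts = mp_bij_inv_simps[OF t(1)]
  let ?c = "\<lambda>U. ae_class M t \<otimes>\<^bsub>Aut M\<^esub> U \<otimes>\<^bsub>Aut M\<^esub> inv\<^bsub>Aut M\<^esub> (ae_class M t)"
  have mult: "ae_class M t \<otimes>\<^bsub>Aut M\<^esub> ae_class M u \<otimes>\<^bsub>Aut M\<^esub> inv\<^bsub>Aut M\<^esub> (ae_class M t) = ae_class M (t \<circ> u \<circ> ?t')"
    if "u \<in> mp_bij M" for u
    using that t t' by (simp add: inv_ae_class Aut_mult mp_bij_comp)
  show ?thesis
  proof
    assume L: ?L
    have "ae_class M ((t \<circ> u \<circ> ?t') \<circ> v) = ae_class M (v \<circ> (t \<circ> u \<circ> ?t'))"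
      if u: "u \<in> mp_bij M" "\<forall>x\<in>space M - A. u x = x" and v: "v \<in> mp_bij M" "\<forall>x\<in>space M - B. v x = x"
      for u v
    proof -
      define w where "w = t \<circ> u \<circ> ?t'"
      have w: "w \<in> mp_bij M" unfolding w_def by (intro mp_bij_comp t u t')
      have w_supp: "w x = x" if x: "x \<in> space M" "x \<notin> t ` A" for x
      proof -
        have "?t' x \<notin> A" using x ts(4)[OF x(1)] by force
        then show ?thesis using u(2) ts x by (simp add: w_def)
      qed
      \<comment> \<open>An injective map that fixes the complement of S pointwise preserves S: if
        \<open>k x\<close> were outside S, then \<open>k (k x) = k x\<close>, so
        \<open>k x = x\<close>.\<close>
      have stable: "k x \<in> S" if k: "k \<in> mp_bij M" "\<And>x. x \<in> space M \<Longrightarrow> x \<notin> S \<Longrightarrow> k x = x"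
        and x: "x \<in> space M" "x \<in> S" for k S x
      proof (rule ccontr)
        assume n: "k x \<notin> S"
        then have "k (k x) = k x" using k x mp_bij_inv_simps(1) by metis
        then have "k x = x"
          using mp_bij_inj[OF k(1)] x(1) mp_bij_inv_simps(1)[OF k(1)] by (auto simp: inj_on_def)
        then show False using n x by simp
      qed
      have "t ` A \<inter> B \<in> null_sets M"
        using L tA B by (auto simp: null_sets_def emeasure_eq_measure)
      then have ae: "AE x in M. x \<notin> t ` A \<inter> B" by (rule AE_not_in)
      \<comment> \<open>The null intersection has to be avoided by x, by \<open>w x\<close> and by
        \<open>v x\<close>, which is why it is also pulled back along w and v.\<close>
      have "AE x in M. (w \<circ> v) x = (v \<circ> w) x"
        using AE_space ae mp_bij_AE[OF w ae] mp_bij_AE[OF v(1) ae]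
      proof eventually_elim
        case (elim x)
        have sp: "w x \<in> space M" "v x \<in> space M" using elim w v mp_bij_inv_simps(1) by auto
        consider "x \<in> t ` A" "x \<notin> B" | "x \<in> B" "x \<notin> t ` A" | "x \<notin> t ` A" "x \<notin> B"
          using elim by blast
        then show ?case
        proof cases
          case 1
          then have "w x \<in> t ` A" using stable[OF w w_supp elim(1)] by blast
          then show ?thesis using 1 elim sp v(2) by auto
        next
          case 2
          then have "v x \<in> B" using stable[OF v(1) _ elim(1), of B] v(2) by blast
          then show ?thesis using 2 elim sp w_supp by auto
        next
          case 3
          then show ?thesis using elim v(2) w_supp by auto
        qed
      qed
      then show ?thesis using w v by (simp add: ae_class_eq_iff mp_bij_comp w_def)
    qed
    note comm = this
    show ?R
    proof (intro ballI)
      fix U V assume "U \<in> supported_in M G A" "V \<in> supported_in M G B"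
      then obtain u v where u: "u \<in> mp_bij M" "\<forall>x\<in>space M - A. u x = x" "U = ae_class M u"
        and v: "v \<in> mp_bij M" "\<forall>x\<in>space M - B. v x = x" "V = ae_class M v"
        unfolding supported_in_def by blast
      have "t \<circ> u \<circ> ?t' \<in> mp_bij M" by (intro mp_bij_comp t u t')
      then show "?c U \<otimes>\<^bsub>Aut M\<^esub> V = V \<otimes>\<^bsub>Aut M\<^esub> ?c U"
        using comm[OF u(1,2) v(1,2)] v(1) unfolding u(3) v(3) mult[OF u(1)] by (simp only: Aut_mult)
    qed
  next
    assume R: ?R
    show ?L
    proof (rule ccontr)
      assume "\<not> ?L"
      then have "measure M (t ` A \<inter> B) > 0" using measure_nonneg[of M "t ` A \<inter> B"] by linarith
      then obtain w v where w: "w \<in> mp_bij M" "ae_class M w \<in> G" and v: "v \<in> mp_bij M" "ae_class M v \<in> G"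
        and supp: "\<And>x. x \<notin> t ` A \<inter> B \<Longrightarrow> w x = x \<and> v x = x"
        and ne: "ae_class M (w \<circ> v) \<noteq> ae_class M (v \<circ> w)"
        using full_group_local_noncommuting[OF M G erg, of "t ` A \<inter> B"] tA B by blast
      define u where "u = ?t' \<circ> w \<circ> t"
      have u: "u \<in> mp_bij M" unfolding u_def by (intro mp_bij_comp t w t')
      have "ae_class M u \<in> G"
        unfolding u_def by (intro subgroup_ae_class[OF sub] mp_bij_comp t w t')
      moreover have "u x = x" if x: "x \<in> space M - A" for x
      proof -
        have "t x \<notin> t ` A"
          using x mp_bij_inj[OF t(1)] sets.sets_into_space[OF A] by (auto simp: inj_on_def)
        then show ?thesis using supp x ts by (simp add: u_def)
      qed
      ultimately have U: "ae_class M u \<in> supported_in M G A" using u by (auto simp: supported_in_def)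
      have V: "ae_class M v \<in> supported_in M G B" using v supp by (auto simp: supported_in_def)
      note wsp = mp_bij_inv_simps(1)[OF w(1)]
      have "AE x in M. (t \<circ> u \<circ> ?t') x = w x"
        by (rule AE_I2) (simp add: u_def ts wsp)
      then have eq: "ae_class M (t \<circ> u \<circ> ?t') = ae_class M w"
        using u t t' w by (simp add: ae_class_eq_iff mp_bij_comp)
      show False
        using R[rule_format, OF U V] ne u v w by (simp add: mult eq Aut_mult)
    qed
  qed
qed

section \<open>Completeness of the joint metric\<close>

text \<open>For fixed U and V the commutation condition equates two continuous maps of T into a
  Hausdorff space, so it is closed; the set in question is the intersection of these conditions.
  This is the only link between the given topology and the action on sets.\<close>

lemma closedin_image_disjoint:
  assumes M: "standard_prob_space M" and G: "full_group M G" and erg: "ergodic M G"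
    and X: "Polish_group_topology ((Aut M)\<lparr>carrier := G\<rparr>) X"
    and A: "A \<in> sets M" and B: "B \<in> sets M"
  shows "closedin X {S\<in>G. \<exists>t\<in>mp_bij M. S = ae_class M t \<and> measure M (t ` A \<inter> B) = 0}"
proof -
  interpret group "Aut M" by (rule group_Aut)
  have sub: "subgroup G (Aut M)" using G by (simp add: full_group_def)
  have top: "topspace X = G" and Hd: "Hausdorff_space X"
    and mult: "continuous_map (prod_topology X X) X (\<lambda>(x, y). x \<otimes>\<^bsub>Aut M\<^esub> y)"
    using X completely_metrizable_imp_metrizable_space metrizable_imp_Hausdorff_space
    by (auto simp: Polish_group_topology_def Polish_space_def)
  have "continuous_map X X (\<lambda>x. inv\<^bsub>(Aut M)\<lparr>carrier := G\<rparr>\<^esub> x)"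
    using X by (simp add: Polish_group_topology_def)
  then have inv: "continuous_map X X (\<lambda>x. inv\<^bsub>Aut M\<^esub> x)"
    by (rule continuous_map_eq) (simp add: top m_inv_consistent[OF sub])
  have mult_cont: "continuous_map X X (\<lambda>x. f x \<otimes>\<^bsub>Aut M\<^esub> g x)"
    if "continuous_map X X f" "continuous_map X X g" for f g
  proof -
    have "continuous_map X (prod_topology X X) (\<lambda>x. (f x, g x))"
      using that by (simp add: continuous_map_paired)
    from continuous_map_compose[OF this mult] show ?thesis by (simp add: o_def)
  qed
  define K where "K = supported_in M G A \<times> supported_in M G B"
  let ?c = "\<lambda>S U. S \<otimes>\<^bsub>Aut M\<^esub> U \<otimes>\<^bsub>Aut M\<^esub> inv\<^bsub>Aut M\<^esub> S"
  have KG: "U \<in> G \<and> V \<in> G" if "(U, V) \<in> K" for U V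
    using that by (auto simp: K_def supported_in_def)
  have "closedin X {S \<in> topspace X. ?c S U \<otimes>\<^bsub>Aut M\<^esub> V = V \<otimes>\<^bsub>Aut M\<^esub> ?c S U}" if "(U, V) \<in> K" for U V
    using KG[OF that]
    by (intro closedin_continuous_maps_eq[OF Hd] mult_cont inv) (auto simp: top)
  \<comment> \<open>The identity pair makes the index set non-empty, as an intersection of closed
    sets requires; it also keeps the intersection inside G.\<close>
  moreover have "(ae_class M id, ae_class M id) \<in> K"
    using subgroup_ae_class(3)[OF sub] mp_bij_id by (fastforce simp: K_def supported_in_def)
  ultimately have "closedin X (\<Inter>(U, V)\<in>K.
      {S \<in> topspace X. ?c S U \<otimes>\<^bsub>Aut M\<^esub> V = V \<otimes>\<^bsub>Aut M\<^esub> ?c S U})"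
    by (intro closedin_INT) auto
  also have "(\<Inter>(U, V)\<in>K. {S \<in> topspace X. ?c S U \<otimes>\<^bsub>Aut M\<^esub> V = V \<otimes>\<^bsub>Aut M\<^esub> ?c S U}) =
      {S\<in>G. \<exists>t\<in>mp_bij M. S = ae_class M t \<and> measure M (t ` A \<inter> B) = 0}" (is "?I = ?J")
  proof -
    have I: "S \<in> ?I \<longleftrightarrow> (\<forall>U\<in>supported_in M G A. \<forall>V\<in>supported_in M G B.
        ?c S U \<otimes>\<^bsub>Aut M\<^esub> V = V \<otimes>\<^bsub>Aut M\<^esub> ?c S U)" if "S \<in> G" for S
      using that by (auto simp: K_def top)
    have "?I \<subseteq> G" using \<open>(ae_class M id, ae_class M id) \<in> K\<close> by (auto simp: top)
    moreover have "S \<in> ?I \<longleftrightarrow> S \<in> ?J" if S: "S \<in> G" for S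
    proof -
      have "S \<in> carrier (Aut M)" using S subgroup.subset[OF sub] by blast
      then obtain t where t: "t \<in> mp_bij M" "S = ae_class M t" by (rule carrier_AutE)
      have *: "S \<in> ?I \<longleftrightarrow> measure M (s ` A \<inter> B) = 0" if "s \<in> mp_bij M" "S = ae_class M s" for s
        unfolding I[OF S] using image_disjoint_iff_commute[OF M G erg that(1) _ A B] S that(2) by simp
      show ?thesis using * t S by blast
    qed
    ultimately show ?thesis by blast
  qed
  finally show ?thesis .
qed

text \<open>If \<open>T n A\<close> moves by at most \<open>e 2^{-j-2}\<close> at the \<open>j\<close>-th step of a subsequence, then the union
  \<open>W\<close> of these images exceeds the first one by at most \<open>e/2\<close>. Each of them avoids the complement
  of \<open>W\<close>, hence so does the limit, which therefore almost fills \<open>W\<close>.\<close>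

lemma act_dist_limit:
  assumes M: "prob_space M" and GA: "G \<subseteq> carrier (Aut M)" and top: "topspace X = G" and A: "A \<in> sets M"
    and closed: "\<And>B. B \<in> sets M \<Longrightarrow>
      closedin X {S\<in>G. \<exists>t\<in>mp_bij M. S = ae_class M t \<and> measure M (t ` A \<inter> B) = 0}"
    and lim: "limitin X T S sequentially" and TG: "\<And>n. T n \<in> G"
    and Cauchy: "\<And>e. e > 0 \<Longrightarrow> \<exists>N. \<forall>m\<ge>N. \<forall>n\<ge>N. act_dist M A (T m) (T n) < e"
  shows "(\<lambda>n. act_dist M A (T n) S) \<longlonglongrightarrow> 0"
proof (rule LIMSEQ_I)
  interpret prob_space M by fact
  fix e0 :: real assume e0: "e0 > 0"
  \<comment> \<open>The final estimate is \<open>e / 4 + e\<close>, below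
    \<open>2 * e = e0\<close>.\<close>
  define e where "e = e0 / 2"
  have e: "e > 0" using e0 by (simp add: e_def)
  have SG: "S \<in> G" using limitin_topspace[OF lim] top by simp
  have "\<exists>t. t \<in> mp_bij M \<and> T n = ae_class M t" for n
    using TG[of n] GA carrier_Aut by blast
  then obtain t where t: "\<And>n. t n \<in> mp_bij M" "\<And>n. T n = ae_class M (t n)" by metis
  have "\<exists>N. \<forall>m\<ge>N. \<forall>n\<ge>N. act_dist M A (T m) (T n) < e / 2 * (1 / 2) ^ Suc j" for j
    using e by (intro Cauchy) simp
  then obtain N where N: "\<And>j m n. m \<ge> N j \<Longrightarrow> n \<ge> N j \<Longrightarrow>
      act_dist M A (T m) (T n) < e / 2 * (1 / 2) ^ Suc j" by metis
  \<comment> \<open>The sum dominates every \<open>N j\<close>, and the summand j makes the sequence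
    strictly increasing.\<close>
  define r where "r j = (\<Sum>i\<le>j. N i) + j" for j
  have r: "strict_mono r" by (rule strict_monoI_Suc) (simp add: r_def)
  have rN: "N j \<le> r j" for j
    using member_le_sum[of j "{..j}" N] by (simp add: r_def)
  define Z where "Z j = t (r j) ` A" for j
  have Z: "Z j \<in> sets M" "measure M (Z j) = measure M A" for j
    using mp_bij_image[OF t(1) A] by (auto simp: Z_def)
  define W where "W = (\<Union>j. Z j)"
  have W: "W \<in> sets M" using Z by (auto simp: W_def)
  have step: "measure M (Z (Suc j) - Z j) \<le> e / 2 * (1 / 2) ^ Suc j" for j
  proof -
    have "N j \<le> r (Suc j)" using rN[of j] strict_monoD[OF r, of j "Suc j"] by simp
    then have "act_dist M A (T (r (Suc j))) (T (r j)) < e / 2 * (1 / 2) ^ Suc j"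
      by (intro N rN)
    then have "measure M (sym_diff (Z (Suc j)) (Z j)) < e / 2 * (1 / 2) ^ Suc j"
      by (simp add: t act_dist_ae_class A Z_def)
    moreover have "measure M (Z (Suc j) - Z j) \<le> measure M (sym_diff (Z (Suc j)) (Z j))"
      using Z by (intro finite_measure_mono) auto
    ultimately show ?thesis by simp
  qed
  have geom: "(\<lambda>j. e / 2 * (1 / 2) ^ Suc j) sums (e / 2)"
    using sums_mult[OF power_half_series, of "e / 2"] by simp
  have "W - Z 0 \<subseteq> (\<Union>j. Z (Suc j) - Z j)"
  proof
    fix x assume x: "x \<in> W - Z 0"
    then obtain j where "x \<in> Z j" by (auto simp: W_def)
    then show "x \<in> (\<Union>j. Z (Suc j) - Z j)"
      by (induction j) (use x in auto)
  qed
  then have "measure M (W - Z 0) \<le> measure M (\<Union>j. Z (Suc j) - Z j)"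
    using Z by (intro finite_measure_mono) auto
  also have "\<dots> \<le> (\<Sum>j. measure M (Z (Suc j) - Z j))"
  proof (rule finite_measure_subadditive_countably)
    show "summable (\<lambda>j. measure M (Z (Suc j) - Z j))"
      by (rule summable_comparison_test'[OF sums_summable[OF geom]]) (use step in auto)
  qed (use Z in auto)
  also have "\<dots> \<le> (\<Sum>j. e / 2 * (1 / 2) ^ Suc j)"
    by (rule suminf_le[OF step _ sums_summable[OF geom]])
      (rule summable_comparison_test'[OF sums_summable[OF geom]], use step in auto)
  also have "\<dots> = e / 2" using geom by (simp only: sums_iff)
  finally have WZ: "measure M (W - Z 0) \<le> e / 2" .
  have disj: "T (r j) \<in> {S\<in>G. \<exists>t\<in>mp_bij M. S = ae_class M t \<and> measure M (t ` A \<inter> (space M - W)) = 0}" for j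
  proof -
    have "t (r j) ` A \<inter> (space M - W) = {}" by (auto simp: W_def Z_def)
    then show ?thesis using t TG[of "r j"] by (auto intro!: bexI[of _ "t (r j)"])
  qed
  have "S \<in> {S\<in>G. \<exists>t\<in>mp_bij M. S = ae_class M t \<and> measure M (t ` A \<inter> (space M - W)) = 0}"
    by (rule limitin_closedin[OF limitin_subsequence[OF r lim] closed])
      (use W disj in \<open>auto simp: o_def\<close>)
  then obtain s where s: "s \<in> mp_bij M" "S = ae_class M s"
    and null: "measure M (s ` A \<inter> (space M - W)) = 0" by blast
  have sA: "s ` A \<in> sets M" "measure M (s ` A) = measure M A" using mp_bij_image[OF s(1) A] by auto
  \<comment> \<open>Up to a null set, the image of A under s and \<open>Z 0\<close> both lie in W,
    and both have the measure of A. Each therefore misses at most \<open>e / 2\<close> of W, so they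
    differ by at most e.\<close>
  have "s ` A \<inter> (space M - W) = s ` A - W" using sets.sets_into_space[OF sA(1)] by blast
  then have "measure M (s ` A \<inter> W) = measure M A"
    using null finite_measure_Diff'[OF sA(1) W] sA(2) by simp
  moreover have "measure M (W - s ` A) = measure M W - measure M (s ` A \<inter> W)"
    using finite_measure_Diff'[OF W sA(1)] by (simp add: Int_commute)
  moreover have "measure M (W - Z 0) = measure M W - measure M A"
    using finite_measure_Diff[OF W Z(1)[of 0]] Z(2)[of 0] by (auto simp: W_def)
  moreover have "measure M (Z 0 - s ` A) \<le> measure M (W - s ` A)"
    using W sA by (intro finite_measure_mono) (auto simp: W_def)
  ultimately have ZsA: "measure M (Z 0 - s ` A) \<le> e / 2" using WZ by simp
  have "measure M (s ` A - Z 0) = measure M (Z 0 - s ` A)"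
    using finite_measure_Diff'[OF sA(1) Z(1)[of 0]] finite_measure_Diff'[OF Z(1)[of 0] sA(1)]
      sA(2) Z(2)[of 0] by (simp add: Int_commute)
  then have "measure M (sym_diff (Z 0) (s ` A)) \<le> e"
    using measure_Un_le[of "Z 0 - s ` A" M "s ` A - Z 0"] sA Z ZsA by simp
  then have first: "act_dist M A (T (r 0)) S \<le> e"
    using t s A by (simp add: act_dist_ae_class Z_def)
  \<comment> \<open>The subsequence has served to compare its first term with S; the Cauchy estimate
    beyond \<open>N 0\<close> carries this over to the whole sequence.\<close>
  have "norm (act_dist M A (T n) S - 0) < e0" if n: "n \<ge> r 0" for n
  proof -
    have "act_dist M A (T n) (T (r 0)) < e / 2 * (1 / 2) ^ Suc 0"
      using n rN[of 0] by (intro N) auto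
    moreover have "act_dist M A (T n) S \<le> act_dist M A (T n) (T (r 0)) + act_dist M A (T (r 0)) S"
      using GA TG SG by (intro act_dist_triangle M A) auto
    ultimately show ?thesis using first act_dist_nonneg[of M A "T n" S] e by (simp add: e_def)
  qed
  then show "\<exists>N. \<forall>n\<ge>N. norm (act_dist M A (T n) S - 0) < e0" by blast
qed

section \<open>A weighted sum of the pseudometrics\<close>

definition weighted_dist :: "'a measure \<Rightarrow> (nat \<Rightarrow> 'a set) \<Rightarrow> ('a \<Rightarrow> 'a) set \<Rightarrow> ('a \<Rightarrow> 'a) set \<Rightarrow> real" where
  "weighted_dist M A S T = (\<Sum>k. (1 / 2) ^ k * act_dist M (A k) S T)"

lemma summable_weighted_dist:
  assumes "prob_space M"
  shows "summable (\<lambda>k. (1 / 2) ^ k * act_dist M (A k) S T)"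
proof (rule summable_comparison_test')
  show "summable (\<lambda>k. (1 / 2 :: real) ^ k)" by (simp add: summable_geometric)
  show "norm ((1 / 2) ^ k * act_dist M (A k) S T) \<le> (1 / 2) ^ k" for k
    using act_dist_le_1[OF assms, of "A k" S T] act_dist_nonneg[of M "A k" S T]
    by (simp add: mult_left_le)
qed

lemma weighted_dist_nonneg: "prob_space M \<Longrightarrow> 0 \<le> weighted_dist M A S T"
  unfolding weighted_dist_def
  by (intro suminf_nonneg summable_weighted_dist mult_nonneg_nonneg act_dist_nonneg) simp_all

lemma weighted_dist_commute: "weighted_dist M A S T = weighted_dist M A T S"
  by (simp add: weighted_dist_def act_dist_commute)

lemma weighted_dist_refl [simp]: "weighted_dist M A S S = 0"
  by (simp add: weighted_dist_def)

lemma weighted_dist_triangle: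
  assumes M: "prob_space M" and "S \<in> carrier (Aut M)" "T \<in> carrier (Aut M)" "U \<in> carrier (Aut M)"
    and "\<And>k. A k \<in> sets M"
  shows "weighted_dist M A S U \<le> weighted_dist M A S T + weighted_dist M A T U"
proof -
  note sm = summable_weighted_dist[OF M]
  have "weighted_dist M A S U \<le>
      (\<Sum>k. (1 / 2) ^ k * act_dist M (A k) S T + (1 / 2) ^ k * act_dist M (A k) T U)"
    unfolding weighted_dist_def
  proof (rule suminf_le)
    show "(1 / 2) ^ k * act_dist M (A k) S U \<le>
        (1 / 2) ^ k * act_dist M (A k) S T + (1 / 2) ^ k * act_dist M (A k) T U" for k
      using act_dist_triangle[OF assms(1-4) assms(5)[of k]]
      by (simp add: distrib_left[symmetric])
  qed (intro sm summable_add)+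
  also have "\<dots> = weighted_dist M A S T + weighted_dist M A T U"
    unfolding weighted_dist_def by (intro suminf_add[symmetric] sm)
  finally show ?thesis .
qed

lemma act_dist_le_weighted_dist:
  assumes "prob_space M"
  shows "act_dist M (A k) S T \<le> 2 ^ k * weighted_dist M A S T"
proof -
  have "(1 / 2) ^ k * act_dist M (A k) S T \<le> weighted_dist M A S T"
    using sum_le_suminf[OF summable_weighted_dist[OF assms], of "{k}" A S T]
    by (simp add: weighted_dist_def act_dist_nonneg)
  then show ?thesis by (simp add: power_one_over field_simps)
qed

text \<open>The first n terms contribute at most e times the sum 2 of the weights; beyond them each
  pseudometric is bounded by 1, and the remaining weights add up to
  \<open>2 * (1 / 2) ^ n\<close>.\<close>

lemma weighted_dist_le:
  assumes M: "prob_space M" and e: "e \<ge> 0" and "\<And>k. k < n \<Longrightarrow> act_dist M (A k) S T \<le> e"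
  shows "weighted_dist M A S T \<le> 2 * e + 2 * (1 / 2) ^ n"
proof -
  let ?f = "\<lambda>k. (1 / 2) ^ k * act_dist M (A k) S T"
  note sm = summable_weighted_dist[OF M, of A S T]
  have g: "(\<lambda>k. (1 / 2 :: real) ^ k) sums 2" using geometric_sums[of "1 / 2 :: real"] by simp
  have "(\<Sum>k. ?f (k + n)) \<le> (\<Sum>k. (1 / 2) ^ n * (1 / 2) ^ k)"
  proof (rule suminf_le)
    show "?f (k + n) \<le> (1 / 2) ^ n * (1 / 2) ^ k" for k
      using act_dist_le_1[OF M, of "A (k + n)" S T] by (simp add: power_add mult_left_le)
    show "summable (\<lambda>k. ?f (k + n))" by (rule summable_ignore_initial_segment[OF sm])
    show "summable (\<lambda>k. (1 / 2 :: real) ^ n * (1 / 2) ^ k)"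
      by (intro summable_mult sums_summable[OF g])
  qed
  also have "\<dots> = 2 * (1 / 2) ^ n" using sums_mult[OF g, of "(1 / 2) ^ n"] by (simp add: sums_iff)
  finally have "(\<Sum>k. ?f (k + n)) \<le> 2 * (1 / 2) ^ n" .
  moreover have "(\<Sum>k<n. ?f k) \<le> 2 * e"
  proof -
    have "(\<Sum>k<n. ?f k) \<le> (\<Sum>k<n. (1 / 2) ^ k * e)"
      by (intro sum_mono mult_left_mono assms(3)) auto
    also have "\<dots> = (\<Sum>k<n. (1 / 2) ^ k) * e" by (simp add: sum_distrib_right)
    also have "\<dots> \<le> 2 * e"
      using sum_le_suminf[OF sums_summable[OF g], of "{..<n}"] g e
      by (intro mult_right_mono) (auto simp: sums_iff)
    finally show ?thesis .
  qed
  ultimately show ?thesis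
    unfolding weighted_dist_def suminf_split_initial_segment[OF sm, of n] by simp
qed

section \<open>The joint metric: completeness, separability, comparison with the weak
  topology\<close>

lemma Metric_space_add_weighted_dist:
  assumes M: "prob_space M" and A: "\<And>k. A k \<in> sets M" and G: "G \<subseteq> carrier (Aut M)"
    and d: "Metric_space G d"
  shows "Metric_space G (\<lambda>S T. d S T + weighted_dist M A S T)"
proof -
  interpret Metric_space G d by fact
  show ?thesis
  proof
    show "0 \<le> d S T + weighted_dist M A S T" for S T
      by (simp add: weighted_dist_nonneg[OF M])
    show "d S T + weighted_dist M A S T = d T S + weighted_dist M A T S" for S T
      using commute weighted_dist_commute by metis
    show "d S T + weighted_dist M A S T = 0 \<longleftrightarrow> S = T" if "S \<in> G" "T \<in> G" for S T
      using that weighted_dist_nonneg[OF M, of A S T] nonneg[of S T] by (auto simp: add_nonneg_eq_0_iff)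
    show "d S U + weighted_dist M A S U \<le> d S T + weighted_dist M A S T + (d T U + weighted_dist M A T U)"
      if "S \<in> G" "T \<in> G" "U \<in> G" for S T U
      using triangle[OF that] weighted_dist_triangle[OF M, of S T U A] that G A by fastforce
  qed
qed

text \<open>A Cauchy sequence for the sum is Cauchy for each summand. Completeness of d yields the
  limit S, and \<open>act_dist_limit\<close> shows that the images of every \<open>A k\<close>
  converge to those under S; the weights make this convergence of the series.\<close>

lemma mcomplete_add_weighted_dist:
  assumes M: "prob_space M" and A: "\<And>k. A k \<in> sets M" and G: "G \<subseteq> carrier (Aut M)"
    and d: "Metric_space G d" and complete: "Metric_space.mcomplete G d"
    and closed: "\<And>B C. B \<in> sets M \<Longrightarrow> C \<in> sets M \<Longrightarrow> closedin (Metric_space.mtopology G d)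
      {S\<in>G. \<exists>t\<in>mp_bij M. S = ae_class M t \<and> measure M (t ` B \<inter> C) = 0}"
  shows "Metric_space.mcomplete G (\<lambda>S T. d S T + weighted_dist M A S T)"
proof -
  let ?D = "\<lambda>S T. d S T + weighted_dist M A S T"
  interpret Metric_space G d by fact
  interpret D: Metric_space G ?D by (rule Metric_space_add_weighted_dist[OF M A G d])
  show ?thesis unfolding D.mcomplete_def
  proof (intro allI impI)
    fix T assume T: "D.MCauchy T"
    then have TG: "\<And>n. T n \<in> G" unfolding D.MCauchy_def by blast
    have Cau: "\<exists>N. \<forall>m\<ge>N. \<forall>n\<ge>N. ?D (T m) (T n) < e" if "e > 0" for e
      using T that unfolding D.MCauchy_def by meson
    have "MCauchy T" unfolding MCauchy_def
    proof (intro conjI allI impI)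
      fix e :: real assume "e > 0"
      then obtain N where "\<And>m n. m \<ge> N \<Longrightarrow> n \<ge> N \<Longrightarrow> ?D (T m) (T n) < e" using Cau by meson
      then have "d (T m) (T n) < e" if "m \<ge> N" "n \<ge> N" for m n
        using that weighted_dist_nonneg[OF M, of A "T m" "T n"] by fastforce
      then show "\<exists>N. \<forall>n n'. N \<le> n \<longrightarrow> N \<le> n' \<longrightarrow> d (T n) (T n') < e" by blast
    qed (use TG in blast)
    then obtain S where S: "limitin mtopology T S sequentially"
      using complete unfolding mcomplete_def by blast
    then have SG: "S \<in> G" and dS: "(\<lambda>n. d (T n) S) \<longlonglongrightarrow> 0"
      by (auto simp: limitin_metric_dist_null)
    have ak: "(\<lambda>n. act_dist M (A k) (T n) S) \<longlonglongrightarrow> 0" for k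
    proof (rule act_dist_limit[OF M G _ A closed[OF A] S TG])
      fix e :: real assume "e > 0"
      then have "e / 2 ^ k > 0" by simp
      then obtain N where N: "\<And>m n. m \<ge> N \<Longrightarrow> n \<ge> N \<Longrightarrow> ?D (T m) (T n) < e / 2 ^ k"
        using Cau by meson
      have "act_dist M (A k) (T m) (T n) < e" if "m \<ge> N" "n \<ge> N" for m n
      proof -
        have "weighted_dist M A (T m) (T n) < e / 2 ^ k"
          using N[OF that] nonneg[of "T m" "T n"] by linarith
        then have "2 ^ k * weighted_dist M A (T m) (T n) < e" by (simp add: field_simps)
        then show ?thesis using act_dist_le_weighted_dist[OF M, of A k "T m" "T n"] by linarith
      qed
      then show "\<exists>N. \<forall>m\<ge>N. \<forall>n\<ge>N. act_dist M (A k) (T m) (T n) < e" by blast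
    qed simp
    have "(\<lambda>n. weighted_dist M A (T n) S) \<longlonglongrightarrow> 0"
    proof (rule LIMSEQ_I)
      fix e :: real assume e: "e > 0"
      \<comment> \<open>With \<open>e / 8\<close> for the first m sets,
        \<open>weighted_dist_le\<close> gives less than
        \<open>2 * (e / 8) + 2 * (e / 4) = 3 * e / 4\<close>.\<close>
      obtain m where m: "(1 / 2 :: real) ^ m < e / 4" using real_arch_pow_inv[of "e / 4" "1 / 2"] e by auto
      have "\<forall>\<^sub>F n in sequentially. \<forall>k\<in>{..<m}. act_dist M (A k) (T n) S < e / 8"
        using order_tendstoD(2)[OF ak, of "e / 8"] e by (intro eventually_ball_finite) auto
      then obtain N where N: "\<And>n k. n \<ge> N \<Longrightarrow> k < m \<Longrightarrow> act_dist M (A k) (T n) S < e / 8"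
        unfolding eventually_sequentially by blast
      have "norm (weighted_dist M A (T n) S - 0) < e" if "n \<ge> N" for n
        using weighted_dist_le[OF M, of "e / 8" m A "T n" S] N[OF that] e m
          weighted_dist_nonneg[OF M, of A "T n" S] by (force simp: less_imp_le)
      then show "\<exists>N. \<forall>n\<ge>N. norm (weighted_dist M A (T n) S - 0) < e" by blast
    qed
    from tendsto_add_zero[OF dS this] show "\<exists>S. limitin D.mtopology T S sequentially"
      by (intro exI[of _ S]) (simp add: D.limitin_metric_dist_null SG TG)
  qed
qed

text \<open>Dense sets for the two summands cannot simply be combined, since a point near to one
  member of each need not be near to a common point of G. Instead G is covered, at each scale n, by
  countably many cells Q: the d-distance to a point c of C and the images of the first n sets are
  prescribed up to 1/(n+1). One point is chosen from each non-empty cell.\<close>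

lemma separable_add_weighted_dist:
  assumes M: "prob_space M" and A: "\<And>k. A k \<in> sets M"
    and dense: "\<And>B e. B \<in> sets M \<Longrightarrow> e > 0 \<Longrightarrow> \<exists>k. measure M (sym_diff (A k) B) < e"
    and G: "G \<subseteq> carrier (Aut M)"
    and d: "Metric_space G d" and sep: "separable_space (Metric_space.mtopology G d)"
  shows "separable_space (Metric_space.mtopology G (\<lambda>S T. d S T + weighted_dist M A S T))"
proof -
  let ?D = "\<lambda>S T. d S T + weighted_dist M A S T"
  interpret prob_space M by fact
  interpret Metric_space G d by fact
  interpret D: Metric_space G ?D by (rule Metric_space_add_weighted_dist[OF M A G d])
  obtain C where C: "countable C" "C \<subseteq> G" "mtopology closure_of C = G"
    using sep unfolding separable_space_def by auto
  have "\<exists>t. S \<in> G \<longrightarrow> t \<in> mp_bij M \<and> S = ae_class M t" for S using G carrier_Aut by blast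
  then obtain t where t: "\<And>S. S \<in> G \<Longrightarrow> t S \<in> mp_bij M" "\<And>S. S \<in> G \<Longrightarrow> S = ae_class M (t S)" by metis
  \<comment> \<open>If the list is shorter than n, the missing entries are unspecified indices, and
    the result is just one more cell.\<close>
  define Q where "Q = (\<lambda>(n, c, is). {S\<in>G. d c S < 1 / real (Suc n) \<and>
    (\<forall>k<n. measure M (sym_diff (A (is ! k)) (t S ` A k)) < 1 / real (Suc n))})"
  define I where "I = {i \<in> UNIV \<times> C \<times> UNIV. Q i \<noteq> {}}"
  define E where "E = (\<lambda>i. SOME S. S \<in> Q i) ` I"
  have E: "(SOME S. S \<in> Q i) \<in> Q i" if "i \<in> I" for i using that by (auto simp: I_def some_in_eq)
  have "countable I" unfolding I_def using C(1) by (intro countable_subset[OF Collect_restrict]) auto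
  then have "countable E" by (simp add: E_def)
  moreover have EG: "E \<subseteq> G" using E by (fastforce simp: E_def Q_def)
  moreover have "D.mtopology closure_of E = G"
  proof
    show "G \<subseteq> D.mtopology closure_of E"
    proof
      fix S assume S: "S \<in> G"
      have "\<exists>R\<in>E. R \<in> D.mball S e" if e: "e > 0" for e
      proof -
        \<comment> \<open>Two points of a cell are within 2/(n+1) for d and within 4/(n+1) plus the
          tail for the weighted sum.\<close>
        have "(\<lambda>n. 6 / real (Suc n) + 2 * (1 / 2) ^ n) \<longlonglongrightarrow> 0" by real_asymp
        then obtain n where n: "6 / real (Suc n) + 2 * (1 / 2) ^ n < e"
          using order_tendstoD(2)[OF _ e] by (fastforce simp: eventually_sequentially)
        let ?e = "1 / real (Suc n)"
        have "S \<in> mtopology closure_of C" using C(3) S by simp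
        then have "\<forall>r>0. \<exists>c\<in>C. c \<in> mball S r" unfolding metric_closure_of by blast
        moreover have "?e > 0" by simp
        ultimately obtain c where c: "c \<in> C" "c \<in> mball S ?e" by meson
        have "\<exists>i. measure M (sym_diff (A i) (t S ` A k)) < ?e" for k
          using mp_bij_image(1)[OF t(1)[OF S] A] by (intro dense) auto
        then obtain i where i: "\<And>k. measure M (sym_diff (A (i k)) (t S ` A k)) < ?e" by metis
        let ?i = "(n, c, map i [0..<n])"
        have "S \<in> Q ?i" using S c i by (simp add: Q_def commute)
        then have "?i \<in> I" using c by (auto simp: I_def)
        define R where "R = (SOME R. R \<in> Q ?i)"
        have RE: "R \<in> E" and R: "R \<in> Q ?i"
          using E[OF \<open>?i \<in> I\<close>] \<open>?i \<in> I\<close> by (auto simp: R_def E_def)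
        have RG: "R \<in> G" using R by (simp add: Q_def)
        have "act_dist M (A k) S R \<le> 2 * ?e" if k: "k < n" for k
        proof -
          have "act_dist M (A k) S R = act_dist M (A k) (ae_class M (t S)) (ae_class M (t R))"
            using t(2)[OF S] t(2)[OF RG] by simp
          also have "\<dots> = measure M (sym_diff (t S ` A k) (t R ` A k))"
            using t(1)[OF S] t(1)[OF RG] A by (rule act_dist_ae_class)
          also have "\<dots> \<le> measure M (sym_diff (t S ` A k) (A (i k))) +
              measure M (sym_diff (A (i k)) (t R ` A k))"
            using t(1)[OF S] t(1)[OF RG] A by (intro measure_sym_diff_triangle M mp_bij_image)
          also have "measure M (sym_diff (A (i k)) (t R ` A k)) < ?e"
            using R k by (simp add: Q_def)
          also have "measure M (sym_diff (t S ` A k) (A (i k))) < ?e"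
            using i[of k] by (simp add: Un_commute)
          finally show ?thesis by simp
        qed
        then have "weighted_dist M A S R \<le> 2 * (2 * ?e) + 2 * (1 / 2) ^ n"
          by (intro weighted_dist_le M) auto
        moreover have "d S R < 2 * ?e"
        proof -
          have "d c R < ?e" using R by (simp add: Q_def)
          moreover have "d S c < ?e" using c(2) by simp
          ultimately show ?thesis using triangle[OF S _ RG, of c] c C(2) by auto
        qed
        ultimately have "?D S R < e" using n by simp
        then show ?thesis using RE RG S by auto
      qed
      then show "S \<in> D.mtopology closure_of E" unfolding D.metric_closure_of using S by blast
    qed
  qed (metis D.topspace_mtopology closure_of_subset_topspace)
  ultimately show ?thesis unfolding separable_space_def by auto
qed

text \<open>A subbasic weak neighbourhood tests an arbitrary measurable B, while the metric sees
  only the dense sequence; \<open>act_dist_change_set\<close> replaces B by a nearby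
  \<open>A k\<close>, whose pseudometric is controlled up to the factor
  \<open>2 ^ k\<close>.\<close>

lemma continuous_map_weighted_dist_weak:
  assumes M: "prob_space M" and A: "\<And>k. A k \<in> sets M"
    and dense: "\<And>B e. B \<in> sets M \<Longrightarrow> e > 0 \<Longrightarrow> \<exists>k. measure M (sym_diff (A k) B) < e"
    and G: "G \<subseteq> carrier (Aut M)" and d: "Metric_space G d"
  shows "continuous_map (Metric_space.mtopology G (\<lambda>S T. d S T + weighted_dist M A S T))
    (weak_topology M) (\<lambda>S. S)"
proof -
  let ?D = "\<lambda>S T. d S T + weighted_dist M A S T"
  interpret Metric_space G d by fact
  interpret D: Metric_space G ?D by (rule Metric_space_add_weighted_dist[OF M A G d])
  have "openin D.mtopology ({ae_class M f |f. f \<in> mp_bij M \<and> measure M (sym_diff (f ` B) (g ` B)) < e} \<inter> G)"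
    if g: "g \<in> mp_bij M" and B: "B \<in> sets M" for g B e
  proof -
    have mem: "S \<in> {ae_class M f |f. f \<in> mp_bij M \<and> measure M (sym_diff (f ` B) (g ` B)) < e} \<longleftrightarrow>
        act_dist M B S (ae_class M g) < e" if "S \<in> carrier (Aut M)" for S
      using that g B by (auto simp: carrier_Aut act_dist_ae_class)
    have gA: "ae_class M g \<in> carrier (Aut M)" using g by (auto simp: carrier_Aut)
    show ?thesis unfolding D.openin_mtopology
    proof (intro conjI allI impI)
      fix S assume "S \<in> {ae_class M f |f. f \<in> mp_bij M \<and> measure M (sym_diff (f ` B) (g ` B)) < e} \<inter> G"
      then have S: "S \<in> G" "act_dist M B S (ae_class M g) < e" using mem G by auto
      define h where "h = e - act_dist M B S (ae_class M g)"
      have h: "h > 0" using S by (simp add: h_def)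
      \<comment> \<open>The slack h is spent as \<open>h / 4\<close> on \<open>A k\<close>, secured
        by the radius r, plus \<open>2 * (h / 8)\<close> for replacing \<open>A k\<close> by
        B.\<close>
      obtain k where k: "measure M (sym_diff (A k) B) < h / 8" using dense[OF B, of "h / 8"] h by auto
      define r where "r = h / 4 / 2 ^ k"
      have "D.mball S r \<subseteq> {ae_class M f |f. f \<in> mp_bij M \<and> measure M (sym_diff (f ` B) (g ` B)) < e} \<inter> G"
      proof
        fix T assume "T \<in> D.mball S r"
        then have T: "T \<in> G" "?D S T < r" by auto
        then have "weighted_dist M A S T < r" using nonneg[of S T] by linarith
        then have "2 ^ k * weighted_dist M A S T < h / 4" by (simp add: r_def field_simps)
        then have "act_dist M (A k) S T < h / 4"
          using act_dist_le_weighted_dist[OF M, of A k S T] by linarith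
        then have "act_dist M B S T < h"
          using act_dist_change_set[OF M _ _ A B, of S T k] S T G k h by fastforce
        then have "act_dist M B T (ae_class M g) < e"
          using act_dist_triangle[OF M _ _ gA B, of T S] S T G
          by (fastforce simp: h_def act_dist_commute[of M B T S])
        then show "T \<in> {ae_class M f |f. f \<in> mp_bij M \<and> measure M (sym_diff (f ` B) (g ` B)) < e} \<inter> G"
          using mem T G by blast
      qed
      moreover have "r > 0" using h by (simp add: r_def)
      ultimately show "\<exists>r>0. D.mball S r \<subseteq>
          {ae_class M f |f. f \<in> mp_bij M \<and> measure M (sym_diff (f ` B) (g ` B)) < e} \<inter> G" by blast
    qed simp
  qed
  then show ?thesis
    unfolding weak_topology_def
  proof (intro continuous_on_generated_topo)
    have "G \<subseteq> topspace (weak_topology M)" using G by (simp add: topspace_weak_topology)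
    then show "(\<lambda>S. S) ` topspace D.mtopology \<subseteq>
      \<Union>{{ae_class M f |f. f \<in> mp_bij M \<and> measure M (sym_diff (f ` A) (g ` A)) < e} |g A e.
       g \<in> mp_bij M \<and> A \<in> sets M \<and> e > 0}"
      unfolding weak_topology_def topology_generated_by_topspace by simp
  qed auto
qed

theorem corollary4p8:
  fixes M :: "'a measure" and G :: "('a \<Rightarrow> 'a) set set"
  assumes "standard_prob_space M"
    and "full_group M G"
    and "ergodic M G"
    and "\<exists>X. Polish_group_topology ((Aut M)\<lparr>carrier := G\<rparr>) X"
  shows "G \<in> borel_sets_of (weak_topology M)"
proof -
  have M: "prob_space M" and sb: "standard_borel_space M"
    using assms(1) by (auto simp: standard_prob_space_def)
  have G: "G \<subseteq> carrier (Aut M)"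
    using assms(2) subgroup.subset by (auto simp: full_group_def)
  obtain X where X: "Polish_group_topology ((Aut M)\<lparr>carrier := G\<rparr>) X" using assms(4) by blast
  then have top: "topspace X = G" and "Polish_space X" by (auto simp: Polish_group_topology_def)
  then obtain P d where P: "Metric_space P d" "Metric_space.mcomplete P d"
    "X = Metric_space.mtopology P d" and sep: "separable_space X"
    unfolding Polish_space_def completely_metrizable_space_def by blast
  have "P = G" using P(1,3) top by (simp add: Metric_space.topspace_mtopology)
  note d = P[unfolded \<open>P = G\<close>]
  obtain A :: "nat \<Rightarrow> 'a set" where A: "\<And>k. A k \<in> sets M"
    "\<And>B e. B \<in> sets M \<Longrightarrow> e > 0 \<Longrightarrow> \<exists>k. measure M (sym_diff (A k) B) < e"
    by (rule countable_dense_sets[OF M sb]) (rule that)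
  let ?D = "\<lambda>S T. d S T + weighted_dist M A S T"
  let ?X = "Metric_space.mtopology G ?D"
  have ms: "Metric_space G ?D" by (rule Metric_space_add_weighted_dist[OF M A(1) G d(1)])
  have "Metric_space.mcomplete G ?D"
    using closedin_image_disjoint[OF assms(1-3) X]
    by (intro mcomplete_add_weighted_dist[OF M A(1) G d(1,2)]) (simp add: d(3))
  then have "Polish_space ?X"
    using ms separable_add_weighted_dist[OF M A G d(1) sep[unfolded d(3)]]
    unfolding Polish_space_def completely_metrizable_space_def by blast
  \<comment> \<open>The map is the inclusion, which is injective, and its image is G itself.\<close>
  from Lusin_Souslin[OF this Hausdorff_weak_topology[OF M sb]
      continuous_map_weighted_dist_weak[OF M A G d(1)]]
  show ?thesis using Metric_space.topspace_mtopology[OF ms] by (simp add: inj_on_def)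
qed

end
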